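(* Let $M$ be an anisotropic submanifold (immersed by $\phi:M\to N$) in an $n$-dimensional Randers space $(N,F,d\mu_{BH})$ with navigation data $(h,W)$. Suppose $F$ has isotropic $\mathbf S$-curvature $\mathbf S=(n+1)k(x)F$. Then for any $\mathbf n\in\mathcal N^0(M)$, with corresponding $h$-unit normal vector $\bar{\mathbf n}=\mathbf n-W$, the shape operator $A_{\mathbf n}$ of $M$ in the Randers space $(N,F)$ and the shape operator $\bar A_{\bar{\mathbf n}}$ of $M$ in the Riemannian space $(N,h)$ have the same principal vectors (eigenvectors), and their principal curvatures satisfy $$\lambda=\bar\lambda+k(x),$$ where $\lambda$ and $\bar\lambda$ are the principal curvatures of $M$ in $(N,F)$ and in $(N,h)$, respectively (for the same principal vector).
   Context: **Randers metrics and navigation data.** Navigation data $(h,W)$ on an $n$-manifold $N$ consist of a Riemannian metric $h$ and a vector field $W=w^i\partial_{x^i}$ with $\|W\|_h<1$. The associated Randers metric is $F(y)=\dfrac{\sqrt{(1-\|W\|_h^2)h(y)^2+w_0^2}-w_0}{1-\|W\|_h^2}$, with $h(y)=\sqrt{h_{ij}y^iy^j}$, $w_i=h_{ij}w^j$, $w_0=w_iy^i$. $d\mu_{BH}$ denotes the Busemann--Hausdorff volume form of $F$. **Finsler objects.** $g_{ij}(x,y)=\frac12[F^2]_{y^iy^j}$, $G^i=\frac14g^{il}\{[F^2]_{x^ky^l}y^k-[F^2]_{x^l}\}$, $N^i_j=\partial G^i/\partial y^j$. The Chern connection coefficients $\Gamma^i_{jk}(x,y)$ satisfy $N^i_j=\Gamma^i_{jk}y^k$,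 and $D^w_vX=\{v^j\partial_{x^j}X^i+\Gamma^i_{jk}(w)v^jX^k\}\partial_{x^i}$. For a volume form $\sigma(x)dx^1\wedge\cdots\wedge dx^n$ (here $d\mu_{BH}$), the $\mathbf S$-curvature is $\mathbf S(x,y)=\frac{\partial G^i}{\partial y^i}-y^i\partial_{x^i}(\ln\sigma)$; it is isotropic if $\mathbf S=(n+1)k(x)F$ for a function $k$ on $N$. **Anisotropic submanifolds.** For an immersion $\phi:M^m\to N^n$, $m<n$, the unit normal bundle $\mathcal N^0(M)$ consists of the $\mathbf n\in T_xN$, $x\in\phi(M)$, with $F(\mathbf n)=1$ and $g_{\mathbf n}(\mathbf n,X)=0$ for all $X\in T_xM$. $M$ equipped with the metrics $g_{\mathbf n}$, $\mathbf n$ a normal vector, is called an anisotropic submanifold. The shape operator is $A_{\mathbf n}X=-(D^{\mathbf n}_X\mathbf n)^\top_{g_{\mathbf n}}$ (tangential part with respect to $g_{\mathbf n}$, with $\mathbf n$ extended to a local section of $\mathcal N^0(M)$; it depends only on the value of $\mathbf n$ at the point). Its eigenvalues and eigenvectors are the principal curvatures and principal vectors. For $\mathbf n\in\mathcal N^0(M)$, the vector $\bar{\mathbf n}:=\mathbf n-W$ is a unit normal vector of $M$ with respect to $h$, and $\bar A_{\bar{\mathbf n}}X=-(\nabla^h_X\bar{\mathbf n})^\top_h$ is the Riemannian shape operator, $\nabla^h$ being the Levi-Civita connection of $h$. *)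

theory Defs
  imports "HOL-Analysis.Analysis"
begin

section \<open>Smooth maps between open subsets of normed spaces\<close>

text \<open>Only meant for open \<open>S\<close>.\<close>

fun Ck_on :: "nat \<Rightarrow> 'a::real_normed_vector set \<Rightarrow> ('a \<Rightarrow> 'b::real_normed_vector) \<Rightarrow> bool" where
  "Ck_on 0 S f \<longleftrightarrow> continuous_on S f"
| "Ck_on (Suc k) S f \<longleftrightarrow>
     (\<forall>x\<in>S. f differentiable (at x)) \<and>
     (\<forall>v. Ck_on k S (\<lambda>x. frechet_derivative f (at x) v))"

definition smooth_on :: "'a::real_normed_vector set \<Rightarrow> ('a \<Rightarrow> 'b::real_normed_vector) \<Rightarrow> bool" where
  "smooth_on S f \<longleftrightarrow> (\<forall>k. Ck_on k S f)"

definition partial :: "'n::finite \<Rightarrow> (real^'n \<Rightarrow> real) \<Rightarrow> real^'n \<Rightarrow> real" where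
  "partial i f x = frechet_derivative f (at x) (axis i 1)"


section \<open>Manifolds, immersions, vector fields and metrics\<close>

text \<open>A chart is a pair of its domain and its coordinate map; the map is irrelevant off the domain.\<close>

type_synonym ('p, 'n) chart = "'p set \<times> ('p \<Rightarrow> real^'n)"

definition chart_inv :: "('p, 'n::finite) chart \<Rightarrow> real^'n \<Rightarrow> 'p" where
  "chart_inv c = inv_into (fst c) (snd c)"

definition is_chart :: "'p topology \<Rightarrow> ('p, 'n::finite) chart \<Rightarrow> bool" where
  "is_chart X c \<longleftrightarrow> openin X (fst c) \<and> open (snd c ` fst c) \<and>
     homeomorphic_map (subtopology X (fst c)) (top_of_set (snd c ` fst c)) (snd c)"

definition smooth_manifold :: "'p topology \<Rightarrow> ('p, 'n::finite) chart set \<Rightarrow> bool" where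
  "smooth_manifold X A \<longleftrightarrow>
     Hausdorff_space X \<and> second_countable X \<and>
     (\<forall>c\<in>A. is_chart X c) \<and> (\<Union>c\<in>A. fst c) = topspace X \<and>
     (\<forall>c\<in>A. \<forall>d\<in>A. smooth_on (snd c ` (fst c \<inter> fst d)) (snd d \<circ> chart_inv c))"

text \<open>The map \<open>\<phi>\<close> read in a chart \<open>d\<close> of the source and a chart \<open>c\<close> of the target, and the open
  coordinate set on which this makes sense.\<close>

definition coord_rep ::
    "('q, 'm::finite) chart \<Rightarrow> ('p, 'n::finite) chart \<Rightarrow> ('q \<Rightarrow> 'p) \<Rightarrow> real^'m \<Rightarrow> real^'n" where
  "coord_rep d c \<phi> = snd c \<circ> \<phi> \<circ> chart_inv d"

definition coord_dom ::
    "('q, 'm::finite) chart \<Rightarrow> ('p, 'n::finite) chart \<Rightarrow> ('q \<Rightarrow> 'p) \<Rightarrow> (real^'m) set" where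
  "coord_dom d c \<phi> = snd d ` {q \<in> fst d. \<phi> q \<in> fst c}"

definition immersion ::
    "'q topology \<Rightarrow> ('q, 'm::finite) chart set \<Rightarrow> 'p topology \<Rightarrow> ('p, 'n::finite) chart set
      \<Rightarrow> ('q \<Rightarrow> 'p) \<Rightarrow> bool" where
  "immersion M AM N AN \<phi> \<longleftrightarrow> continuous_map M N \<phi> \<and>
     (\<forall>d\<in>AM. \<forall>c\<in>AN. smooth_on (coord_dom d c \<phi>) (coord_rep d c \<phi>) \<and>
        (\<forall>s\<in>coord_dom d c \<phi>. inj (frechet_derivative (coord_rep d c \<phi>) (at s))))"

text \<open>Tensor fields are families of component functions, one for each chart, on the coordinate
  image of the chart, which obey the tensor transformation law.\<close>

definition vector_field ::
    "('p, 'n::finite) chart set \<Rightarrow> (('p, 'n) chart \<Rightarrow> real^'n \<Rightarrow> real^'n) \<Rightarrow> bool" where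
  "vector_field A W \<longleftrightarrow>
     (\<forall>c\<in>A. smooth_on (snd c ` fst c) (W c)) \<and>
     (\<forall>c\<in>A. \<forall>d\<in>A. \<forall>p\<in>fst c \<inter> fst d.
        W d (snd d p) =
          frechet_derivative (snd d \<circ> chart_inv c) (at (snd c p)) (W c (snd c p)))"

definition riemannian_metric ::
    "('p, 'n::finite) chart set \<Rightarrow> (('p, 'n) chart \<Rightarrow> real^'n \<Rightarrow> real^'n^'n) \<Rightarrow> bool" where
  "riemannian_metric A h \<longleftrightarrow>
     (\<forall>c\<in>A. smooth_on (snd c ` fst c) (h c) \<and>
        (\<forall>x\<in>snd c ` fst c. transpose (h c x) = h c x \<and> (\<forall>v. v \<noteq> 0 \<longrightarrow> v \<bullet> (h c x *v v) > 0))) \<and>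
     (\<forall>c\<in>A. \<forall>d\<in>A. \<forall>p\<in>fst c \<inter> fst d. \<forall>u v.
        let J = frechet_derivative (snd d \<circ> chart_inv c) (at (snd c p))
        in u \<bullet> (h c (snd c p) *v v) = J u \<bullet> (h d (snd d p) *v J v))"

definition navigation_data ::
    "('p, 'n::finite) chart set \<Rightarrow> (('p, 'n) chart \<Rightarrow> real^'n \<Rightarrow> real^'n^'n)
      \<Rightarrow> (('p, 'n) chart \<Rightarrow> real^'n \<Rightarrow> real^'n) \<Rightarrow> bool" where
  "navigation_data A h W \<longleftrightarrow> riemannian_metric A h \<and> vector_field A W \<and>
     (\<forall>c\<in>A. \<forall>x\<in>snd c ` fst c. sqrt (W c x \<bullet> (h c x *v W c x)) < 1)"


section \<open>Finsler objects in local coordinates\<close>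

text \<open>Below, \<open>F x y\<close> is the value of a Finsler metric at the tangent vector with components \<open>y\<close>
  at the point with coordinates \<open>x\<close>.\<close>

definition randers ::
    "(real^'n \<Rightarrow> real^'n^'n) \<Rightarrow> (real^'n \<Rightarrow> real^'n) \<Rightarrow> real^'n \<Rightarrow> real^'n::finite \<Rightarrow> real" where
  "randers h W x y =
     (let W2 = W x \<bullet> (h x *v W x); h2 = y \<bullet> (h x *v y); w0 = (h x *v W x) \<bullet> y
      in (sqrt ((1 - W2) * h2 + w0\<^sup>2) - w0) / (1 - W2))"

text \<open>Density of the Busemann--Hausdorff volume form with respect to \<open>dx\<^sup>1 \<and> \<dots> \<and> dx\<^sup>n\<close>.\<close>

definition BH_density :: "(real^'n \<Rightarrow> real^'n \<Rightarrow> real) \<Rightarrow> real^'n::finite \<Rightarrow> real" where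
  "BH_density F x = measure lebesgue (ball (0::real^'n) 1) / measure lebesgue {y. F x y < 1}"

definition fund :: "(real^'n \<Rightarrow> real^'n \<Rightarrow> real) \<Rightarrow> real^'n \<Rightarrow> real^'n \<Rightarrow> real^'n^'n::finite" where
  "fund F x y = (\<chi> i j. partial j (partial i (\<lambda>z. (F x z)\<^sup>2)) y / 2)"

definition spray :: "(real^'n \<Rightarrow> real^'n \<Rightarrow> real) \<Rightarrow> 'n \<Rightarrow> real^'n \<Rightarrow> real^'n::finite \<Rightarrow> real" where
  "spray F i x y = 1/4 * (\<Sum>l\<in>UNIV. matrix_inv (fund F x y) $ i $ l *
     ((\<Sum>k\<in>UNIV. partial l (\<lambda>z. partial k (\<lambda>x'. (F x' z)\<^sup>2) x) y * y $ k)
       - partial l (\<lambda>x'. (F x' y)\<^sup>2) x))"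

definition nonlin_conn ::
    "(real^'n \<Rightarrow> real^'n \<Rightarrow> real) \<Rightarrow> 'n \<Rightarrow> 'n \<Rightarrow> real^'n \<Rightarrow> real^'n::finite \<Rightarrow> real" where
  "nonlin_conn F i j x y = partial j (spray F i x) y"

text \<open>The horizontal derivative \<open>\<delta>/\<delta>x\<^sup>j = \<partial>/\<partial>x\<^sup>j - N\<^sup>m\<^sub>j \<partial>/\<partial>y\<^sup>m\<close>.\<close>

definition hor_deriv ::
    "(real^'n \<Rightarrow> real^'n \<Rightarrow> real) \<Rightarrow> 'n \<Rightarrow> (real^'n \<Rightarrow> real^'n \<Rightarrow> real)
      \<Rightarrow> real^'n \<Rightarrow> real^'n::finite \<Rightarrow> real" where
  "hor_deriv F j f x y =
     partial j (\<lambda>x'. f x' y) x - (\<Sum>m\<in>UNIV. nonlin_conn F m j x y * partial m (f x) y)"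

text \<open>The Chern connection is the torsion-free, almost metric compatible connection; its
  coefficients \<open>\<Gamma>\<^sup>i\<^sub>j\<^sub>k\<close> are given by the Christoffel formula with horizontal derivatives.\<close>

definition chern ::
    "(real^'n \<Rightarrow> real^'n \<Rightarrow> real) \<Rightarrow> real^'n \<Rightarrow> real^'n \<Rightarrow> 'n \<Rightarrow> 'n \<Rightarrow> 'n::finite \<Rightarrow> real" where
  "chern F x y i j k = 1/2 * (\<Sum>l\<in>UNIV. matrix_inv (fund F x y) $ i $ l *
     (hor_deriv F j (\<lambda>x y. fund F x y $ l $ k) x y
      + hor_deriv F k (\<lambda>x y. fund F x y $ j $ l) x y
      - hor_deriv F l (\<lambda>x y. fund F x y $ j $ k) x y))"

definition christoffel ::
    "(real^'n \<Rightarrow> real^'n^'n) \<Rightarrow> real^'n \<Rightarrow> 'n \<Rightarrow> 'n \<Rightarrow> 'n::finite \<Rightarrow> real" where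
  "christoffel h x i j k = 1/2 * (\<Sum>l\<in>UNIV. matrix_inv (h x) $ i $ l *
     (partial j (\<lambda>x. h x $ l $ k) x + partial k (\<lambda>x. h x $ j $ l) x
      - partial l (\<lambda>x. h x $ j $ k) x))"

definition S_curvature ::
    "(real^'n \<Rightarrow> real^'n \<Rightarrow> real) \<Rightarrow> (real^'n \<Rightarrow> real) \<Rightarrow> real^'n \<Rightarrow> real^'n::finite \<Rightarrow> real" where
  "S_curvature F \<sigma> x y =
     (\<Sum>i\<in>UNIV. partial i (spray F i x) y) - (\<Sum>i\<in>UNIV. y $ i * partial i (\<lambda>x. ln (\<sigma> x)) x)"

text \<open>Isotropic \<open>S\<close>-curvature of the Randers space \<open>(N, F, d\<mu>\<^sub>B\<^sub>H)\<close>. As usual, tangent vectors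
  are taken in the slit tangent bundle, where \<open>F\<close> is smooth.\<close>

definition isotropic_S_curvature ::
    "('p, 'n::finite) chart set \<Rightarrow> (('p, 'n) chart \<Rightarrow> real^'n \<Rightarrow> real^'n^'n)
      \<Rightarrow> (('p, 'n) chart \<Rightarrow> real^'n \<Rightarrow> real^'n) \<Rightarrow> ('p \<Rightarrow> real) \<Rightarrow> bool" where
  "isotropic_S_curvature A h W k \<longleftrightarrow>
     (\<forall>c\<in>A. \<forall>p\<in>fst c. \<forall>y. y \<noteq> 0 \<longrightarrow>
        S_curvature (randers (h c) (W c)) (BH_density (randers (h c) (W c))) (snd c p) y
          = (real CARD('n) + 1) * k p * randers (h c) (W c) (snd c p) y)"


section \<open>Normal vectors and shape operators\<close>

text \<open>Here \<open>f\<close> is a coordinate representation of an immersion, with domain \<open>V\<close>. Everything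
  is attached to the parameter \<open>s\<close> rather than to the image point \<open>f s\<close>, and the tangent space of
  the submanifold at \<open>s\<close> is the range of the derivative of \<open>f\<close>, identified with \<open>real^'m\<close>; this
  is how the notions are understood at self-intersections of the immersed submanifold.\<close>

definition unit_normal ::
    "(real^'n \<Rightarrow> real^'n \<Rightarrow> real) \<Rightarrow> (real^'m::finite \<Rightarrow> real^'n::finite)
      \<Rightarrow> real^'m \<Rightarrow> real^'n \<Rightarrow> bool" where
  "unit_normal F f s n \<longleftrightarrow> F (f s) n = 1 \<and>
     (\<forall>u. n \<bullet> (fund F (f s) n *v frechet_derivative f (at s) u) = 0)"

definition riem_unit_normal ::
    "(real^'n \<Rightarrow> real^'n^'n) \<Rightarrow> (real^'m::finite \<Rightarrow> real^'n::finite)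
      \<Rightarrow> real^'m \<Rightarrow> real^'n \<Rightarrow> bool" where
  "riem_unit_normal h f s n \<longleftrightarrow> n \<bullet> (h (f s) *v n) = 1 \<and>
     (\<forall>u. n \<bullet> (h (f s) *v frechet_derivative f (at s) u) = 0)"

text \<open>Smooth section, near \<open>s\<close>, of the bundle of vectors satisfying \<open>P\<close>, with value \<open>n\<close> at \<open>s\<close>.\<close>

definition local_section ::
    "(real^'m \<Rightarrow> real^'n \<Rightarrow> bool) \<Rightarrow> (real^'m::finite) set \<Rightarrow> real^'m \<Rightarrow> real^'n::finite
      \<Rightarrow> (real^'m \<Rightarrow> real^'n) \<Rightarrow> bool" where
  "local_section P V s n \<nu> \<longleftrightarrow> \<nu> s = n \<and>
     (\<exists>S. open S \<and> s \<in> S \<and> S \<subseteq> V \<and> smooth_on S \<nu> \<and> (\<forall>t\<in>S. P t (\<nu> t)))"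

text \<open>Covariant derivative at \<open>s\<close>, in direction \<open>u\<close>, of a vector field \<open>X\<close> along \<open>f\<close>, for
  connection coefficients \<open>\<Gamma>\<close> at the point \<open>f s\<close> (and reference vector, where applicable).\<close>

definition cov_along ::
    "('n \<Rightarrow> 'n \<Rightarrow> 'n \<Rightarrow> real) \<Rightarrow> (real^'m::finite \<Rightarrow> real^'n::finite)
      \<Rightarrow> (real^'m \<Rightarrow> real^'n) \<Rightarrow> real^'m \<Rightarrow> real^'m \<Rightarrow> real^'n" where
  "cov_along \<Gamma> f X s u = frechet_derivative X (at s) u +
     (\<chi> i. \<Sum>j\<in>UNIV. \<Sum>k\<in>UNIV. \<Gamma> i j k * frechet_derivative f (at s) u $ j * X s $ k)"

text \<open>Tangential part of \<open>Z\<close> with respect to the inner product with matrix \<open>g\<close>, as an element of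
  \<open>real^'m\<close>, where \<open>L\<close> is the (injective) derivative of the immersion.\<close>

definition tangential :: "real^'n^'n \<Rightarrow> (real^'m \<Rightarrow> real^'n) \<Rightarrow> real^'n::finite \<Rightarrow> real^'m::finite" where
  "tangential g L Z = (THE v. \<forall>u. (Z - L v) \<bullet> (g *v L u) = 0)"

text \<open>Both shape operators differentiate a local extension of the normal vector to a section of the
  unit normal bundle. Such extensions always exist and the result does not depend on the choice.\<close>

definition shape_operator ::
    "(real^'n \<Rightarrow> real^'n \<Rightarrow> real) \<Rightarrow> (real^'m::finite \<Rightarrow> real^'n::finite) \<Rightarrow> (real^'m) set
      \<Rightarrow> real^'m \<Rightarrow> real^'n \<Rightarrow> real^'m \<Rightarrow> real^'m" where
  "shape_operator F f V s n u =
     (let \<nu> = (SOME \<nu>. local_section (unit_normal F f) V s n \<nu>)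
      in - tangential (fund F (f s) n) (frechet_derivative f (at s))
             (cov_along (chern F (f s) n) f \<nu> s u))"

definition riem_shape_operator ::
    "(real^'n \<Rightarrow> real^'n^'n) \<Rightarrow> (real^'m::finite \<Rightarrow> real^'n::finite) \<Rightarrow> (real^'m) set
      \<Rightarrow> real^'m \<Rightarrow> real^'n \<Rightarrow> real^'m \<Rightarrow> real^'m" where
  "riem_shape_operator h f V s n u =
     (let \<nu> = (SOME \<nu>. local_section (riem_unit_normal h f) V s n \<nu>)
      in - tangential (h (f s)) (frechet_derivative f (at s))
             (cov_along (christoffel h (f s)) f \<nu> s u))"

definition principal_pair :: "('a::real_vector \<Rightarrow> 'a) \<Rightarrow> 'a \<Rightarrow> real \<Rightarrow> bool" where
  "principal_pair A v \<kappa> \<longleftrightarrow> v \<noteq> 0 \<and> A v = \<kappa> *\<^sub>R v"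

definition principal_vector :: "('a::real_vector \<Rightarrow> 'a) \<Rightarrow> 'a \<Rightarrow> bool" where
  "principal_vector A v \<longleftrightarrow> (\<exists>\<kappa>. principal_pair A v \<kappa>)"

end

(* Write eta = y - F W, so that h(eta, eta) = F^2 (Zermelo navigation), and R for half the Lie derivative of h
   along W. Differentiating this equation implicitly gives the spray of F explicitly, and its trace gives
   S = -(n+1)/2 R(eta, eta)/F for the Busemann-Hausdorff volume, whose density is sqrt (det h). Hence isotropic
   S-curvature means R = -2k h.
   On the other side, the fundamental tensor at a unit normal n is on tangent vectors a multiple of h, and the
   second fundamental form of M at n depends on the spray only through the Euler-Lagrange equation along (y, -2G).
   It turns out to be the Riemannian one at eta = n - W plus R - R(eta, eta)/2 h = -k h, which is the claim. *)

theory Submission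
  imports Defs
begin

section \<open>Bilinear forms given by matrices\<close>

text \<open>The closed form of F hides its derivatives behind a square root. Differentiating
  h(\<eta>, \<eta>) = F^2 instead brings in \<open>cc\<close>, the coefficient of the unknown
  derivative of F; it is positive, so all derivatives are rational in F, \<eta> and
  \<open>cc\<close>. Of \<open>h\<close> and \<open>W\<close>, only values and first derivatives
  enter the local computation. The spray can drop out because the nonlinear connection contracts
  with y to 2G by homogeneity: the horizontal lift of y is the vector (y, -2G) itself, and
  contraction of the Chern coefficients with the reference vector leaves no other derivative of g
  than the one in this direction. The term with R(\<eta>, \<eta>)/2 also stems from
  \<open>cc\<close>: on tangent vectors g is (F/cc) h, and \<open>cc\<close> changes along (y, -2G)
  at the rate R(\<eta>, \<eta>) cc / F. Both shape operators select a normal section by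
  \<open>SOME\<close>, so nothing can be said about them before smooth sections are known to exist.
  Adding W carries sections for h to sections for F, which reduces this to the Riemannian
  case.\<close>

definition bf :: "real^'n^'n \<Rightarrow> real^'n \<Rightarrow> real^'n \<Rightarrow> real" where
  "bf A u v = u \<bullet> (A *v v)"

lemma bf_add [simp]:
  "bf (A + B) u v = bf A u v + bf B u v"
  "bf A (u + w) v = bf A u v + bf A w v"
  "bf A u (v + w) = bf A u v + bf A u w"
  by (simp_all add: bf_def matrix_vector_mult_add_rdistrib inner_add matrix_vector_right_distrib)

lemma bf_scaleR [simp]:
  "bf (r *\<^sub>R A) u v = r * bf A u v"
  "bf A (r *\<^sub>R u) v = r * bf A u v"
  "bf A u (r *\<^sub>R v) = r * bf A u v"
  by (simp_all add: bf_def matrix_vector_mult_scaleR scaleR_matrix_vector_assoc[symmetric])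

lemma bf_zero [simp]: "bf 0 u v = 0" "bf A 0 v = 0" "bf A u 0 = 0"
  by (simp_all add: bf_def)

lemma bf_minus [simp]:
  "bf (- A) u v = - bf A u v" "bf A (- u) v = - bf A u v" "bf A u (- v) = - bf A u v"
  using bf_scaleR(1)[of "-1" A] bf_scaleR(2)[of A "-1"] bf_scaleR(3)[of A _ "-1"] by simp_all

lemma bf_diff [simp]:
  "bf (A - B) u v = bf A u v - bf B u v"
  "bf A (u - w) v = bf A u v - bf A w v"
  "bf A u (v - w) = bf A u v - bf A u w"
  by (simp_all only: diff_conv_add_uminus bf_add bf_minus)

lemma bf_sum:
  "bf A (sum f S) v = (\<Sum>i\<in>S. bf A (f i) v)" "bf A u (sum f S) = (\<Sum>i\<in>S. bf A u (f i))"
  by (simp_all add: bf_def inner_sum_left inner_sum_right linear_sum)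

lemma bf_axis: "bf A (axis i 1) (axis j 1) = A $ i $ j"
  by (simp add: bf_def matrix_vector_mult_basis inner_axis' column_def)

lemma bf_expand: "bf A u v = (\<Sum>i\<in>UNIV. \<Sum>j\<in>UNIV. A $ i $ j * u $ i * v $ j)"
  by (simp add: bf_def inner_vec_def matrix_vector_mult_def sum_distrib_left algebra_simps)

lemma bf_commute: "transpose A = A \<Longrightarrow> bf A u v = bf A v u"
  by (metis bf_def dot_lmul_matrix inner_commute transpose_matrix_vector)

lemma bounded_bilinear_matrix_vector:
  "bounded_bilinear (\<lambda>(A::real^'n^'m) (v::real^'n). A *v v)"
proof -
  have "bilinear (\<lambda>(A::real^'n^'m) (v::real^'n). A *v v)"
    unfolding bilinear_def
    by (auto intro!: linearI simp: matrix_vector_mult_add_rdistrib matrix_vector_right_distrib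
        matrix_vector_mult_scaleR scaleR_matrix_vector_assoc[symmetric])
  then show ?thesis by (simp add: bilinear_conv_bounded_bilinear)
qed

lemma has_derivative_bf [derivative_intros]:
  assumes "(A has_derivative A') (at t within S)" "(u has_derivative u') (at t within S)"
    and "(v has_derivative v') (at t within S)"
  shows "((\<lambda>t. bf (A t) (u t) (v t)) has_derivative
      (\<lambda>d. bf (A' d) (u t) (v t) + bf (A t) (u' d) (v t) + bf (A t) (u t) (v' d))) (at t within S)"
  unfolding bf_def
  by (rule has_derivative_eq_rhs[OF has_derivative_inner[OF assms(2)
        bounded_bilinear.FDERIV[OF bounded_bilinear_matrix_vector assms(1,3)]]])
     (simp add: inner_add algebra_simps fun_eq_iff)

section \<open>The Randers metric as solution of the navigation equation\<close>

text \<open>The data in one chart. Derivatives are parameters, hence mere linear maps in the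
  computations; smoothness of \<open>h\<close> and \<open>W\<close> enters only where normal
  sections are built.\<close>

locale randers_data =
  fixes U :: "(real^'n::finite) set" and h :: "real^'n \<Rightarrow> real^'n^'n" and W :: "real^'n \<Rightarrow> real^'n"
    and Dh :: "real^'n \<Rightarrow> real^'n \<Rightarrow> real^'n^'n" and DW :: "real^'n \<Rightarrow> real^'n \<Rightarrow> real^'n"
  assumes open_U: "open U"
    and h_deriv: "x \<in> U \<Longrightarrow> (h has_derivative Dh x) (at x)"
    and W_deriv: "x \<in> U \<Longrightarrow> (W has_derivative DW x) (at x)"
    and h_sym: "x \<in> U \<Longrightarrow> transpose (h x) = h x"
    and h_pos: "x \<in> U \<Longrightarrow> v \<noteq> 0 \<Longrightarrow> bf (h x) v v > 0"
    and W_small: "x \<in> U \<Longrightarrow> bf (h x) (W x) (W x) < 1"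
begin

abbreviation "F \<equiv> randers h W"

text \<open>Zermelo navigation: \<open>F x y\<close> is the positive solution of \<open>h (\<eta>, \<eta>) = F\<^sup>2\<close>; \<open>cc x y\<close> is the square root in
  the formula for \<open>F\<close>.\<close>

definition "\<eta> x y = y - F x y *\<^sub>R W x"
definition "cc x y = F x y + bf (h x) (\<eta> x y) (W x)"

text \<open>The derivatives of \<open>F\<close> in the fibre and in the base direction.\<close>

definition "ell x y Z = bf (h x) (\<eta> x y) Z / cc x y"
definition "phi x y a = (bf (Dh x a) (\<eta> x y) (\<eta> x y) / 2 - F x y * bf (h x) (\<eta> x y) (DW x a)) / cc x y"

lemma h_comm: "x \<in> U \<Longrightarrow> bf (h x) u v = bf (h x) v u"
  by (rule bf_commute[OF h_sym])

lemma h_nonneg: "x \<in> U \<Longrightarrow> bf (h x) v v \<ge> 0"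
  using h_pos[of x v] by (cases "v = 0") (auto simp: less_imp_le)

lemma Dh_linear: "x \<in> U \<Longrightarrow> linear (Dh x)"
  using h_deriv has_derivative_linear by blast

lemma DW_linear: "x \<in> U \<Longrightarrow> linear (DW x)"
  using W_deriv has_derivative_linear by blast

lemma Dh_lin:
  assumes "x \<in> U"
  shows "Dh x (a + b) = Dh x a + Dh x b" "Dh x (a - b) = Dh x a - Dh x b"
    "Dh x (r *\<^sub>R a) = r *\<^sub>R Dh x a" "Dh x (- a) = - Dh x a" "Dh x 0 = 0"
  using Dh_linear[OF assms] by (simp_all add: linear_add linear_diff linear_scale linear_neg linear_0)

lemma DW_lin:
  assumes "x \<in> U"
  shows "DW x (a + b) = DW x a + DW x b" "DW x (a - b) = DW x a - DW x b"
    "DW x (r *\<^sub>R a) = r *\<^sub>R DW x a" "DW x (- a) = - DW x a" "DW x 0 = 0"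
  using DW_linear[OF assms] by (simp_all add: linear_add linear_diff linear_scale linear_neg linear_0)

lemma Dh_comm:
  assumes "x \<in> U" shows "bf (Dh x a) u v = bf (Dh x a) v u"
proof -
  have d: "((\<lambda>x. bf (h x) u v) has_derivative (\<lambda>a. bf (Dh x a) u v)) (at x)" for u v
    using has_derivative_bf[OF h_deriv[OF assms] has_derivative_const has_derivative_const, of u v]
    by simp
  have "((\<lambda>x. bf (h x) v u) has_derivative (\<lambda>a. bf (Dh x a) u v)) (at x)"
    by (rule has_derivative_transform_within_open[OF d open_U assms]) (rule h_comm)
  from has_derivative_unique[OF this d] show ?thesis by metis
qed

lemma navigation_root:
  assumes x: "x \<in> U"
  defines "w2 \<equiv> bf (h x) (W x) (W x)"
  shows F_pos: "y \<noteq> 0 \<Longrightarrow> F x y > 0"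
    and navigation: "bf (h x) (\<eta> x y) (\<eta> x y) = (F x y)\<^sup>2"
    and cc_pos: "y \<noteq> 0 \<Longrightarrow> cc x y > 0"
    and F_unique: "r \<ge> 0 \<Longrightarrow> y \<noteq> 0 \<Longrightarrow> bf (h x) (y - r *\<^sub>R W x) (y - r *\<^sub>R W x) = r\<^sup>2 \<Longrightarrow> r = F x y"
proof -
  define l where "l = 1 - w2"
  have l: "l > 0" using W_small[OF x] by (simp add: l_def w2_def)
  define w0 where "w0 = bf (h x) y (W x)"
  define h2 where "h2 = bf (h x) y y"
  define q where "q = sqrt (l * h2 + w0\<^sup>2)"
  have F: "F x y = (q - w0) / l"
    by (simp add: randers_def Let_def q_def l_def w2_def w0_def h2_def bf_def inner_commute)
  have h2: "h2 \<ge> 0" by (simp add: h2_def h_nonneg x)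
  have rad: "l * h2 + w0\<^sup>2 \<ge> 0" using l h2 by simp
  then have q2: "q\<^sup>2 = l * h2 + w0\<^sup>2" by (simp add: q_def)
  have q0: "q \<ge> 0" using rad by (simp add: q_def)
  have "q \<ge> w0" unfolding q_def using l h2 by (simp add: real_le_rsqrt)
  then have Fnn: "F x y \<ge> 0" using l by (simp add: F)
  have lF: "l * F x y = q - w0" using l by (simp add: F)
  \<comment> \<open>The navigation equation is a quadratic in \<open>r\<close>; \<open>F x y\<close>
    is its root with the positive sign of the square root \<open>q\<close>.\<close>
  have quad: "l * r\<^sup>2 + 2 * w0 * r - h2 = 0 \<longleftrightarrow> bf (h x) (y - r *\<^sub>R W x) (y - r *\<^sub>R W x) = r\<^sup>2" for r
    by (auto simp: l_def w2_def w0_def h2_def h_comm[OF x, of "W x" y] algebra_simps power2_eq_square)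
  have "l * (l * (F x y)\<^sup>2 + 2 * w0 * F x y - h2) = (l * F x y + w0)\<^sup>2 - w0\<^sup>2 - l * h2"
    by (simp add: power2_eq_square algebra_simps)
  also have "\<dots> = 0" by (simp add: lF q2)
  finally have rt: "l * (F x y)\<^sup>2 + 2 * w0 * F x y - h2 = 0" using l by simp
  then show "bf (h x) (\<eta> x y) (\<eta> x y) = (F x y)\<^sup>2" by (simp only: quad \<eta>_def)
  have cq: "cc x y = q"
    using lF by (simp add: cc_def \<eta>_def l_def w0_def w2_def algebra_simps)
  assume y: "y \<noteq> 0"
  then have h2p: "h2 > 0" by (simp add: h2_def h_pos x)
  then have "F x y \<noteq> 0" using rt by auto
  then show "F x y > 0" using Fnn by simp
  have qp: "q > 0" using q_def l h2p by (simp add: add_pos_nonneg)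
  then show "cc x y > 0" by (simp add: cq)
  assume r: "r \<ge> 0" "bf (h x) (y - r *\<^sub>R W x) (y - r *\<^sub>R W x) = r\<^sup>2"
  then have r2: "l * r\<^sup>2 + 2 * w0 * r - h2 = 0" by (simp only: quad)
  have "(l * r + w0)\<^sup>2 = l * (l * r\<^sup>2 + 2 * w0 * r - h2) + (l * h2 + w0\<^sup>2)"
    by (simp add: power2_eq_square algebra_simps)
  then have "(l * r + w0)\<^sup>2 = q\<^sup>2" using r2 q2 by simp
  \<comment> \<open>Excludes the other root: with \<open>r \<ge> 0\<close>, a negative value would
    write \<open>h2\<close> as a sum of two nonpositive terms.\<close>
  moreover have "l * r + w0 \<ge> 0"
  proof (rule ccontr)
    assume "\<not> ?thesis"
    then have a: "l * r + w0 < 0" by simp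
    have "r * (l * r + w0) + r * w0 = h2" using r2 by (simp add: power2_eq_square algebra_simps)
    moreover have "r * (l * r + w0) \<le> 0" using a r(1) by (simp add: mult_nonneg_nonpos)
    moreover have "w0 \<le> 0" using a l r(1) mult_nonneg_nonneg[of l r] by linarith
    then have "r * w0 \<le> 0" using r(1) by (simp add: mult_nonneg_nonpos)
    ultimately show False using h2p by linarith
  qed
  ultimately have "l * r + w0 = q" using q0 by (metis power2_eq_imp_eq)
  then show "r = F x y" using l by (simp add: F field_simps)
qed

lemma F_zero: "x \<in> U \<Longrightarrow> F x 0 = 0"
  by (simp add: randers_def)

end

section \<open>Derivatives of the Randers metric\<close>

context randers_data
begin

lemma ell_lin:
  "ell x y (a + b) = ell x y a + ell x y b" "ell x y (a - b) = ell x y a - ell x y b"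
  "ell x y (r *\<^sub>R a) = r * ell x y a" "ell x y (- a) = - ell x y a"
  by (simp_all add: ell_def add_divide_distrib diff_divide_distrib)

lemma phi_lin:
  assumes "x \<in> U"
  shows "phi x y (a + b) = phi x y a + phi x y b" "phi x y (r *\<^sub>R a) = r * phi x y a"
  by (simp_all add: phi_def Dh_lin[OF assms] DW_lin[OF assms] add_divide_distrib diff_divide_distrib algebra_simps)

lemma ell_y:
  assumes "x \<in> U" "y \<noteq> 0"
  shows "ell x y y = F x y" "ell x y (\<eta> x y) * cc x y = (F x y)\<^sup>2"
    "ell x y (W x) * cc x y = cc x y - F x y"
proof -
  have c: "cc x y > 0" by (rule cc_pos[OF assms])
  show "ell x y (\<eta> x y) * cc x y = (F x y)\<^sup>2"
    using c by (simp add: ell_def navigation assms)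
  have "bf (h x) (\<eta> x y) y = bf (h x) (\<eta> x y) (\<eta> x y) + F x y * bf (h x) (\<eta> x y) (W x)"
    by (simp add: \<eta>_def)
  also have "\<dots> = F x y * cc x y"
    by (simp add: navigation assms cc_def power2_eq_square algebra_simps)
  finally show "ell x y y = F x y" using c by (simp add: ell_def)
  show "ell x y (W x) * cc x y = cc x y - F x y"
    using c by (simp add: ell_def cc_def)
qed

text \<open>The formula with the square root only yields that some derivative exists; its value
  comes from the differentiated navigation equation, solved for the unknown by dividing by
  \<open>cc\<close>. Both arguments may move, so that one rule serves the fibre, the base and vector
  fields along the immersion.\<close>

lemma has_derivative_F:
  assumes X: "(X has_derivative X') (at t)" and Y: "(Y has_derivative Y') (at t)"
    and x: "X t \<in> U" and y: "Y t \<noteq> 0"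
  shows "((\<lambda>t. F (X t) (Y t)) has_derivative
      (\<lambda>d. phi (X t) (Y t) (X' d) + ell (X t) (Y t) (Y' d))) (at t)"
proof -
  have hX [derivative_intros]: "((\<lambda>t. h (X t)) has_derivative (\<lambda>d. Dh (X t) (X' d))) (at t)"
    by (rule has_derivative_compose[OF X h_deriv[OF x]])
  have WX [derivative_intros]: "((\<lambda>t. W (X t)) has_derivative (\<lambda>d. DW (X t) (X' d))) (at t)"
    by (rule has_derivative_compose[OF X W_deriv[OF x]])
  have l: "1 - bf (h (X t)) (W (X t)) (W (X t)) > 0"
    and l0: "1 - bf (h (X t)) (W (X t)) (W (X t)) \<noteq> 0" using W_small[OF x] by auto
  have F_eq: "F a b = (sqrt ((1 - bf (h a) (W a) (W a)) * bf (h a) b b + (bf (h a) b (W a))\<^sup>2)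
        - bf (h a) b (W a)) / (1 - bf (h a) (W a) (W a))" for a b
    by (simp add: randers_def Let_def bf_def inner_commute)
  have rad: "(1 - bf (h (X t)) (W (X t)) (W (X t))) * bf (h (X t)) (Y t) (Y t)
      + (bf (h (X t)) (Y t) (W (X t)))\<^sup>2 > 0"
    using l h_pos[OF x y] by (simp add: add_pos_nonneg)
  note w' = has_derivative_bf[OF hX Y WX]
    and l' = has_derivative_diff[OF has_derivative_const has_derivative_bf[OF hX WX WX]]
  have "\<exists>D. ((\<lambda>t. F (X t) (Y t)) has_derivative D) (at t)"
    unfolding F_eq
    by (rule exI) (rule has_derivative_divide'[OF has_derivative_diff[OF has_derivative_real_sqrt[OF rad
        has_derivative_add[OF has_derivative_mult[OF l' has_derivative_bf[OF hX Y Y]]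
        has_derivative_power[OF w']]] w'] l' l0])
  then obtain D where D: "((\<lambda>t. F (X t) (Y t)) has_derivative D) (at t)" ..
  let ?x = "X t" and ?y = "Y t"
  define e' where "e' d = Y' d - D d *\<^sub>R W ?x - F ?x ?y *\<^sub>R DW ?x (X' d)" for d
  have e: "((\<lambda>t. \<eta> (X t) (Y t)) has_derivative e') (at t)"
    unfolding \<eta>_def
    by (rule has_derivative_eq_rhs[OF has_derivative_diff[OF Y has_derivative_scaleR[OF D WX]]])
       (simp add: fun_eq_iff e'_def)
  have lhs: "((\<lambda>t. bf (h (X t)) (\<eta> (X t) (Y t)) (\<eta> (X t) (Y t))) has_derivative
     (\<lambda>d. bf (Dh ?x (X' d)) (\<eta> ?x ?y) (\<eta> ?x ?y)
        + 2 * bf (h ?x) (\<eta> ?x ?y) (e' d))) (at t)"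
  proof (rule has_derivative_eq_rhs[OF has_derivative_bf[OF hX e e]])
    show "(\<lambda>d. bf (Dh ?x (X' d)) (\<eta> ?x ?y) (\<eta> ?x ?y) + bf (h ?x) (e' d) (\<eta> ?x ?y)
         + bf (h ?x) (\<eta> ?x ?y) (e' d))
      = (\<lambda>d. bf (Dh ?x (X' d)) (\<eta> ?x ?y) (\<eta> ?x ?y) + 2 * bf (h ?x) (\<eta> ?x ?y)
         (e' d))" (is "?lhs = ?rhs")
    proof
      fix d
      show "?lhs d = ?rhs d" using h_comm[OF x, of "e' d" "\<eta> ?x ?y"] by linarith
    qed
  qed
  have ev: "\<forall>\<^sub>F s in at t. X s \<in> U"
    by (rule topological_tendstoD[OF isContD[OF has_derivative_continuous[OF X]] open_U x])
  have rhs: "((\<lambda>t. bf (h (X t)) (\<eta> (X t) (Y t)) (\<eta> (X t) (Y t))) has_derivative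
     (\<lambda>d. 2 * F ?x ?y * D d)) (at t)"
  proof (rule has_derivative_transform_eventually)
    show "((\<lambda>t. (F (X t) (Y t))\<^sup>2) has_derivative (\<lambda>d. 2 * F ?x ?y * D d)) (at t)"
      by (rule derivative_eq_intros D refl)+ (simp add: fun_eq_iff)
    show "\<forall>\<^sub>F s in at t. (F (X s) (Y s))\<^sup>2 = bf (h (X s)) (\<eta> (X s) (Y s)) (\<eta> (X s) (Y s))"
      using ev by eventually_elim (simp add: navigation)
  qed (use x in \<open>simp_all add: navigation\<close>)
  have "D d = phi ?x ?y (X' d) + ell ?x ?y (Y' d)" for d
  proof -
    have "bf (Dh ?x (X' d)) (\<eta> ?x ?y) (\<eta> ?x ?y)
        + 2 * bf (h ?x) (\<eta> ?x ?y) (e' d)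
        = 2 * F ?x ?y * D d"
      using has_derivative_unique[OF lhs rhs] by metis
    then have "cc ?x ?y * D d = bf (Dh ?x (X' d)) (\<eta> ?x ?y) (\<eta> ?x ?y) / 2
        - F ?x ?y * bf (h ?x) (\<eta> ?x ?y) (DW ?x (X' d)) + bf (h ?x) (\<eta> ?x ?y) (Y' d)"
      by (simp add: cc_def e'_def algebra_simps)
    then show ?thesis
      using cc_pos[OF x y] by (simp add: phi_def ell_def field_simps)
  qed
  then have "D = (\<lambda>d. phi ?x ?y (X' d) + ell ?x ?y (Y' d))" by (rule ext)
  with D show ?thesis by simp
qed

text \<open>Joint derivatives of \<open>\<eta>\<close>, \<open>cc\<close> and \<open>ell\<close> at \<open>(x, y)\<close> in the direction \<open>(a, b)\<close>.\<close>

definition "dF x y a b = phi x y a + ell x y b"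
definition "d\<eta> x y a b = b - dF x y a b *\<^sub>R W x - F x y *\<^sub>R DW x a"
definition "dcc x y a b = dF x y a b + bf (Dh x a) (\<eta> x y) (W x)
  + bf (h x) (d\<eta> x y a b) (W x) + bf (h x) (\<eta> x y) (DW x a)"
definition "dell x y a b Z = (bf (Dh x a) (\<eta> x y) Z + bf (h x) (d\<eta> x y a b) Z
  - ell x y Z * dcc x y a b) / cc x y"
definition "dphi x y b a = (bf (Dh x a) (\<eta> x y) (d\<eta> x y 0 b) - dF x y 0 b * bf (h x) (\<eta> x y) (DW x a)
  - F x y * bf (h x) (d\<eta> x y 0 b) (DW x a) - phi x y a * dcc x y 0 b) / cc x y"

lemma phi_zero [simp]: "x \<in> U \<Longrightarrow> phi x y 0 = 0"
  by (simp add: phi_def Dh_lin DW_lin)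

lemma ell_zero [simp]: "ell x y 0 = 0"
  by (simp add: ell_def)

context
  fixes X Y :: "'t::real_normed_vector \<Rightarrow> real^'n" and X' Y' t
  assumes X: "(X has_derivative X') (at t)" and Y: "(Y has_derivative Y') (at t)"
    and x: "X t \<in> U" and y: "Y t \<noteq> 0"
begin

lemma has_derivative_dF:
  "((\<lambda>t. F (X t) (Y t)) has_derivative (\<lambda>d. dF (X t) (Y t) (X' d) (Y' d))) (at t)"
  using has_derivative_F[OF X Y x y] by (simp add: dF_def)

lemma has_derivative_h: "((\<lambda>t. h (X t)) has_derivative (\<lambda>d. Dh (X t) (X' d))) (at t)"
  by (rule has_derivative_compose[OF X h_deriv[OF x]])

lemma has_derivative_W: "((\<lambda>t. W (X t)) has_derivative (\<lambda>d. DW (X t) (X' d))) (at t)"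
  by (rule has_derivative_compose[OF X W_deriv[OF x]])

lemma has_derivative_\<eta>:
  "((\<lambda>t. \<eta> (X t) (Y t)) has_derivative (\<lambda>d. d\<eta> (X t) (Y t) (X' d) (Y' d))) (at t)"
  unfolding \<eta>_def
  by (rule derivative_eq_intros has_derivative_dF has_derivative_W Y refl)+
     (simp add: fun_eq_iff d\<eta>_def algebra_simps)

lemma has_derivative_cc:
  "((\<lambda>t. cc (X t) (Y t)) has_derivative (\<lambda>d. dcc (X t) (Y t) (X' d) (Y' d))) (at t)"
  unfolding cc_def
  by (rule derivative_eq_intros has_derivative_dF has_derivative_W has_derivative_h has_derivative_\<eta> refl)+
     (simp add: fun_eq_iff dcc_def algebra_simps)

lemma has_derivative_ell:
  assumes Z: "(Z has_derivative Z') (at t)"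
  shows "((\<lambda>t. ell (X t) (Y t) (Z t)) has_derivative
    (\<lambda>d. dell (X t) (Y t) (X' d) (Y' d) (Z t) + ell (X t) (Y t) (Z' d))) (at t)"
proof -
  have c: "cc (X t) (Y t) \<noteq> 0" using cc_pos[OF x y] by simp
  note num = has_derivative_bf[OF has_derivative_h has_derivative_\<eta> Z]
  show ?thesis
    unfolding ell_def
    by (rule has_derivative_eq_rhs[OF has_derivative_divide'[OF num has_derivative_cc c]])
       (use c in \<open>simp add: fun_eq_iff dell_def ell_def field_simps\<close>)
qed

end

lemma has_derivative_phi:
  assumes x: "x \<in> U" and y: "y \<noteq> 0"
  shows "((\<lambda>y. phi x y a) has_derivative (\<lambda>b. dphi x y b a)) (at y)"
proof -
  note d = has_derivative_const has_derivative_ident x y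
  have z: "bf (Dh x a) (\<eta> x y) v = bf (Dh x a) v (\<eta> x y)" for v
    by (rule Dh_comm[OF x])
  have c: "cc x y \<noteq> 0" using cc_pos[OF x y] by simp
  note e = has_derivative_\<eta>[OF d]
  have "((\<lambda>y. bf (Dh x a) (\<eta> x y) (\<eta> x y) / 2 - F x y * bf (h x) (\<eta> x y) (DW x a)) has_derivative
      (\<lambda>b. bf (Dh x a) (\<eta> x y) (d\<eta> x y 0 b) - dF x y 0 b * bf (h x) (\<eta> x y) (DW x a)
        - F x y * bf (h x) (d\<eta> x y 0 b) (DW x a))) (at y)"
    by (rule has_derivative_eq_rhs[OF has_derivative_diff[OF
          has_derivative_divide'[OF has_derivative_bf[OF has_derivative_const e e] has_derivative_const]
          has_derivative_mult[OF has_derivative_dF[OF d]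
            has_derivative_bf[OF has_derivative_const e has_derivative_const]]]])
       (simp_all add: fun_eq_iff z[of "d\<eta> _ _ _ _"])
  from has_derivative_divide'[OF this has_derivative_cc[OF d] c]
  show ?thesis
    unfolding phi_def
    by (rule has_derivative_eq_rhs) (use c in \<open>simp add: fun_eq_iff dphi_def phi_def field_simps\<close>)
qed

text \<open>Symmetry of mixed second derivatives of \<open>F\<close>; the metric is only assumed differentiable in the
  base point, so this is verified on the formulas.\<close>

lemma dphi_eq_dell:
  assumes x: "x \<in> U"
  shows "dphi x y Z a = dell x y a 0 Z"
proof -
  define p l where "p = phi x y a" and "l = ell x y Z"
  have d: "dF x y 0 Z = l" "dF x y a 0 = p" using x by (simp_all add: dF_def p_def l_def)
  show ?thesis
    unfolding dphi_def dell_def p_def[symmetric] l_def[symmetric]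
    by (rule arg_cong[where f = "\<lambda>u. u / cc x y"])
      (simp add: d\<eta>_def dcc_def d Dh_lin[OF x] DW_lin[OF x] algebra_simps
        h_comm[OF x, of "DW x a" Z] h_comm[OF x, of "DW x a" "W x"] h_comm[OF x, of "W x" Z])
qed

end

section \<open>Fundamental tensor and spray\<close>

lemma partial_eq: "(f has_derivative D) (at x) \<Longrightarrow> partial i f x = D (axis i 1)"
  unfolding partial_def by (metis frechet_derivative_at)

lemma linear_expand:
  fixes f :: "real^'n \<Rightarrow> real"
  assumes "linear f" shows "f u = (\<Sum>i\<in>UNIV. u $ i * f (axis i 1))"
proof -
  have "f u = f (\<Sum>i\<in>UNIV. u $ i *\<^sub>R axis i 1)"
    by (simp add: basis_expansion scalar_mult_eq_scaleR[symmetric])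
  also have "\<dots> = (\<Sum>i\<in>UNIV. u $ i * f (axis i 1))"
    using assms by (simp add: linear_sum linear_scale)
  finally show ?thesis .
qed

lemma bf_of_bilinear:
  assumes "\<And>v. linear (\<lambda>u. G u v)" "\<And>u. linear (G u)"
  shows "bf (\<chi> i j. G (axis i 1) (axis j 1)) u v = G u v"
  unfolding bf_expand
  by (subst linear_expand[OF assms(1)], subst linear_expand[OF assms(2)])
     (simp add: sum_distrib_left algebra_simps)

lemma invertible_of_kernel:
  fixes A :: "real^'n^'n"
  assumes "\<And>v. (\<And>w. bf A w v = 0) \<Longrightarrow> v = 0" shows "invertible A"
proof -
  have "\<forall>v. A *v v = 0 \<longrightarrow> v = 0" using assms by (metis bf_def inner_zero_right)
  then show ?thesis using matrix_left_invertible_ker[of A] invertible_left_inverse by blast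
qed

lemma matrix_inv_apply:
  fixes A :: "real^'n^'n"
  assumes "invertible A" shows "matrix_inv A *v (A *v v) = v" "A *v (matrix_inv A *v v) = v"
proof -
  have "A ** matrix_inv A = mat 1 \<and> matrix_inv A ** A = mat 1"
    using assms unfolding matrix_inv_def invertible_def by (rule someI_ex)
  then show "matrix_inv A *v (A *v v) = v" "A *v (matrix_inv A *v v) = v"
    by (simp_all add: matrix_vector_mul_assoc)
qed

lemma bf_axis_left: "bf A (axis i 1) v = (A *v v) $ i"
  by (simp add: bf_def inner_axis')

context randers_data
begin

lemma dF_lin:
  assumes x: "x \<in> U"
  shows "dF x y (a + a') (b + b') = dF x y a b + dF x y a' b'"
    "dF x y (r *\<^sub>R a) (r *\<^sub>R b) = r * dF x y a b"
  by (simp_all add: dF_def phi_lin[OF x] ell_lin algebra_simps)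

lemma d\<eta>_lin:
  assumes x: "x \<in> U"
  shows "d\<eta> x y (a + a') (b + b') = d\<eta> x y a b + d\<eta> x y a' b'"
    "d\<eta> x y (r *\<^sub>R a) (r *\<^sub>R b) = r *\<^sub>R d\<eta> x y a b"
  by (simp_all add: d\<eta>_def dF_lin[OF x] DW_lin[OF x] algebra_simps)

lemma dcc_lin:
  assumes x: "x \<in> U"
  shows "dcc x y (a + a') (b + b') = dcc x y a b + dcc x y a' b'"
    "dcc x y (r *\<^sub>R a) (r *\<^sub>R b) = r * dcc x y a b"
  by (simp_all add: dcc_def d\<eta>_lin[OF x] dF_lin[OF x] DW_lin[OF x] Dh_lin[OF x] algebra_simps)

lemma dell_lin:
  assumes x: "x \<in> U"
  shows "dell x y (a + a') (b + b') Z = dell x y a b Z + dell x y a' b' Z"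
    "dell x y (r *\<^sub>R a) (r *\<^sub>R b) Z = r * dell x y a b Z"
    "dell x y a b (Z + Z') = dell x y a b Z + dell x y a b Z'"
    "dell x y a b (r *\<^sub>R Z) = r * dell x y a b Z"
  by (simp_all add: dell_def d\<eta>_lin[OF x] dcc_lin[OF x] Dh_lin[OF x] ell_lin
      add_divide_distrib diff_divide_distrib algebra_simps)

lemma dell_split:
  assumes x: "x \<in> U"
  shows "dell x y a b Z = dell x y a 0 Z + dell x y 0 b Z"
  using dell_lin(1)[OF x, of y a 0 0 b Z] by simp

lemma dell_linear:
  assumes x: "x \<in> U"
  shows "linear (\<lambda>a. dell x y a 0 Z)" "linear (\<lambda>b. dell x y 0 b Z)" "linear (dell x y a b)"
  using dell_lin(1)[OF x, of y _ _ 0 0] dell_lin(2)[OF x, of y _ _ 0]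
    dell_lin(1)[OF x, of y 0 0] dell_lin(2)[OF x, of y _ 0] dell_lin(3,4)[OF x]
  by (auto intro!: linearI)

lemma phi_linear: "x \<in> U \<Longrightarrow> linear (phi x y)"
  by (auto intro!: linearI simp: phi_lin)

text \<open>The fundamental tensor: half the second fibre derivative of \<open>F\<^sup>2\<close>,
  written out by the product rule.\<close>

definition "gm x y Y Z = ell x y Y * ell x y Z + F x y * dell x y 0 Y Z"

lemma gm_eq:
  assumes x: "x \<in> U"
  shows "gm x y Y Z = ell x y Y * ell x y Z + F x y / cc x y *
    (bf (h x) Y Z - ell x y Y * bf (h x) (W x) Z - ell x y Z * bf (h x) (W x) Y
      - ell x y Y * ell x y Z * (1 - bf (h x) (W x) (W x)))"
proof -
  define l m where "l = ell x y Y" and "m = ell x y Z"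
  have d: "dF x y 0 Y = l" using x by (simp add: dF_def l_def)
  show ?thesis
    unfolding gm_def dell_def l_def[symmetric] m_def[symmetric]
    by (simp add: dcc_def d\<eta>_def d Dh_lin[OF x] DW_lin[OF x] h_comm[OF x, of "Y" "W x"] add_divide_distrib diff_divide_distrib algebra_simps)
qed

lemma gm_comm: "x \<in> U \<Longrightarrow> gm x y Y Z = gm x y Z Y"
  by (simp add: gm_eq h_comm[of x Y Z])

lemma gm_linear:
  assumes x: "x \<in> U"
  shows "linear (\<lambda>Y. gm x y Y Z)" "linear (gm x y Y)"
proof -
  show "linear (gm x y Y)" for Y
    by (rule linearI) (simp_all add: gm_def ell_lin dell_lin[OF x] algebra_simps)
  then show "linear (\<lambda>Y. gm x y Y Z)" by (simp add: gm_comm[OF x, of y _ Z])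
qed

text \<open>Euler's relation for the 2-homogeneous \<open>F\<^sup>2\<close>. It turns
  g-orthogonality to \<open>y\<close> into \<open>ell x y Y = 0\<close>.\<close>

lemma gm_y:
  assumes x: "x \<in> U" and y: "y \<noteq> 0"
  shows "gm x y Y y = F x y * ell x y Y"
proof -
  have c: "cc x y \<noteq> 0" using cc_pos[OF x y] by simp
  have yy: "y = \<eta> x y + F x y *\<^sub>R W x" by (simp add: \<eta>_def)
  have hY: "bf (h x) Y y = cc x y * ell x y Y + F x y * bf (h x) (W x) Y"
    using c h_comm[OF x, of Y "\<eta> x y"] h_comm[OF x, of Y "W x"] by (subst yy) (simp add: ell_def)
  have hW: "bf (h x) (W x) y = cc x y - F x y + F x y * bf (h x) (W x) (W x)"
    using h_comm[OF x, of "W x" "\<eta> x y"] by (subst yy) (simp add: cc_def)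
  have "bf (h x) Y y - ell x y Y * bf (h x) (W x) y - F x y * bf (h x) (W x) Y
      - ell x y Y * F x y * (1 - bf (h x) (W x) (W x)) = 0"
    unfolding hY hW by (simp add: algebra_simps)
  then show ?thesis
    by (simp add: gm_eq[OF x] ell_y[OF x y])
qed

text \<open>Every correction term in \<open>gm_eq\<close> carries a factor \<open>ell\<close>. This
  conformality is what makes tangential parts for g and for \<open>h\<close> comparable.\<close>

lemma gm_tangent:
  assumes "x \<in> U" "ell x y Y = 0" "ell x y Z = 0"
  shows "gm x y Y Z = F x y / cc x y * bf (h x) Y Z"
  using assms by (simp add: gm_eq)

text \<open>Testing against \<open>y\<close> forces \<open>ell x y Y = 0\<close>, and on that
  hyperplane the tensor is a positive multiple of \<open>h\<close>.\<close>

lemma gm_nondegenerate: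
  assumes x: "x \<in> U" and y: "y \<noteq> 0" and z: "\<And>Z. gm x y Z Y = 0"
  shows "Y = 0"
proof (rule ccontr)
  assume "Y \<noteq> 0"
  have "F x y * ell x y Y = 0"
    using gm_y[OF x y, of Y] gm_comm[OF x, of y Y y] z[of y] by simp
  then have "ell x y Y = 0" using F_pos[OF x y] by simp
  then show False
    using gm_tangent[OF x, of y Y Y] z[of Y] h_pos[OF x \<open>Y \<noteq> 0\<close>] F_pos[OF x y] cc_pos[OF x y] by simp
qed

lemma open_nonzero: "open {y::real^'n. y \<noteq> 0}"
  by (simp add: open_Collect_neq)

lemma has_derivative_F2_y:
  assumes x: "x \<in> U" and y: "y \<noteq> 0"
  shows "((\<lambda>y. (F x y)\<^sup>2) has_derivative (\<lambda>b. 2 * F x y * ell x y b)) (at y)"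
  by (rule derivative_eq_intros has_derivative_F[OF has_derivative_const has_derivative_ident x y] refl)+
     (simp add: x fun_eq_iff)

lemma has_derivative_F2_x:
  assumes x: "x \<in> U" and y: "y \<noteq> 0"
  shows "((\<lambda>x. (F x y)\<^sup>2) has_derivative (\<lambda>a. 2 * F x y * phi x y a)) (at x)"
  by (rule derivative_eq_intros has_derivative_F[OF has_derivative_ident has_derivative_const x y] refl)+
     (simp add: x fun_eq_iff)

lemma fund_component:
  assumes x: "x \<in> U" and y: "y \<noteq> 0"
  shows "fund F x y $ i $ j = gm x y (axis i 1) (axis j 1)"
proof -
  note d = has_derivative_const has_derivative_ident x y
  let ?e = "axis i 1 :: real^'n"
  have "((\<lambda>y. 2 * F x y * ell x y ?e) has_derivative
      (\<lambda>b. 2 * gm x y b ?e)) (at y)"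
    by (rule derivative_eq_intros has_derivative_F[OF d] has_derivative_ell[OF d has_derivative_const] refl)+
       (simp add: x fun_eq_iff gm_def algebra_simps)
  then have "((\<lambda>y. partial i (\<lambda>z. (F x z)\<^sup>2) y) has_derivative (\<lambda>b. 2 * gm x y b ?e)) (at y)"
    by (rule has_derivative_transform_within_open[OF _ open_nonzero])
       (use y in \<open>auto simp: partial_eq[OF has_derivative_F2_y[OF x]]\<close>)
  then show ?thesis
    by (simp add: fund_def partial_eq gm_comm[OF x, of y ?e])
qed

lemma bf_fund:
  assumes x: "x \<in> U" and y: "y \<noteq> 0"
  shows "bf (fund F x y) Y Z = gm x y Y Z"
proof -
  have "fund F x y = (\<chi> i j. gm x y (axis i 1) (axis j 1))"
    by (simp add: vec_eq_iff fund_component[OF x y])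
  then show ?thesis by (simp add: bf_of_bilinear gm_linear[OF x])
qed

lemma fund_invertible:
  assumes x: "x \<in> U" and y: "y \<noteq> 0" shows "invertible (fund F x y)"
  by (rule invertible_of_kernel) (simp add: bf_fund[OF x y] gm_nondegenerate[OF x y])

lemma h_invertible: "x \<in> U \<Longrightarrow> invertible (h x)"
  by (rule invertible_of_kernel) (metis h_pos less_irrefl)

text \<open>Half the Lie derivative of \<open>h\<close> along \<open>W\<close>.\<close>

definition "R x X Y = (bf (Dh x (W x)) X Y + bf (h x) X (DW x Y) + bf (h x) (DW x X) Y) / 2"

definition "P x y Z = bf (Dh x y) (\<eta> x y) Z - F x y * bf (h x) Z (DW x y)
  - bf (Dh x Z) (\<eta> x y) (\<eta> x y) / 2 + F x y * bf (h x) (\<eta> x y) (DW x Z)"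

text \<open>Found by solving the Euler-Lagrange equation along (y, -2G) for h(G, Z).
  \<open>P\<close> collects the terms in which \<open>cc\<close> counts as constant; the term with
  \<open>R\<close> is \<open>ell x y Z\<close> times the rate R(\<eta>, \<eta>) cc / F at which
  \<open>cc\<close> changes.\<close>

definition "Gv x y = matrix_inv (h x) *v
  (\<chi> i. (P x y (axis i 1) - R x (\<eta> x y) (\<eta> x y) * bf (h x) (\<eta> x y) (axis i 1) / F x y) / 2)"

lemma P_linear: "x \<in> U \<Longrightarrow> linear (P x y)"
  by (rule linearI)
     (simp_all add: P_def Dh_lin DW_lin add_divide_distrib diff_divide_distrib algebra_simps)

lemma h_Gv:
  assumes x: "x \<in> U"
  shows "2 * bf (h x) (Gv x y) Z = P x y Z - R x (\<eta> x y) (\<eta> x y) * bf (h x) (\<eta> x y) Z / F x y"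
proof -
  let ?Q = "\<lambda>Z. P x y Z - R x (\<eta> x y) (\<eta> x y) * bf (h x) (\<eta> x y) Z / F x y"
  have l: "linear ?Q"
    using P_linear[OF x] by (auto intro!: linearI simp: linear_add linear_scale add_divide_distrib algebra_simps)
  have "h x *v Gv x y = (\<chi> i. ?Q (axis i 1) / 2)"
    unfolding Gv_def by (rule matrix_inv_apply(2)[OF h_invertible[OF x]])
  then have "2 * bf (h x) Z (Gv x y) = (\<Sum>i\<in>UNIV. Z $ i * ?Q (axis i 1))"
    by (simp add: bf_def inner_vec_def sum_distrib_left)
  then show ?thesis
    using linear_expand[OF l, of Z] h_comm[OF x, of Z "Gv x y"] by simp
qed

lemma R_comm: "x \<in> U \<Longrightarrow> R x X Y = R x Y X"
  by (simp add: R_def Dh_comm[of x "W x" X Y] h_comm[of x X "DW x Y"] h_comm[of x Y "DW x X"])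

lemma R_lin:
  assumes "x \<in> U"
  shows "R x (X + X') Y = R x X Y + R x X' Y" "R x (r *\<^sub>R X) Y = r * R x X Y"
    "R x Y (X + X') = R x Y X + R x Y X'" "R x Y (r *\<^sub>R X) = r * R x Y X"
    "R x Y (X - X') = R x Y X - R x Y X'" "R x (X - X') Y = R x X Y - R x X' Y"
  by (simp_all add: R_def DW_lin[OF assms] add_divide_distrib diff_divide_distrib algebra_simps)

context
  fixes x y :: "real^'n" assumes x: "x \<in> U" and y: "y \<noteq> 0"
begin

lemma y_eq: "y = \<eta> x y + F x y *\<^sub>R W x" by (simp add: \<eta>_def)

lemma Dh_y: "Dh x y = Dh x (\<eta> x y) + F x y *\<^sub>R Dh x (W x)"
  by (subst (1) y_eq) (simp only: Dh_lin[OF x])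

lemma DW_y: "DW x y = DW x (\<eta> x y) + F x y *\<^sub>R DW x (W x)"
  by (subst (1) y_eq) (simp only: DW_lin[OF x])

lemma cc_phi: "cc x y * phi x y a =
    bf (Dh x a) (\<eta> x y) (\<eta> x y) / 2 - F x y * bf (h x) (\<eta> x y) (DW x a)"
  using cc_pos[OF x y] by (simp add: phi_def)

lemma cc_ell: "cc x y * ell x y Z = bf (h x) (\<eta> x y) Z"
  using cc_pos[OF x y] by (simp add: ell_def)

text \<open>Along the geodesic vector field \<open>(y, -2G)\<close> the value \<open>F\<close> is constant and \<open>ell\<close> satisfies the
  Euler-Lagrange equation.\<close>

lemma dF_geodesic: "dF x y y (- 2 *\<^sub>R Gv x y) = 0"
proof -
  have F: "F x y \<noteq> 0" using F_pos[OF x y] by simp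
  have R: "2 * R x (\<eta> x y) (\<eta> x y) = bf (Dh x (W x)) (\<eta> x y) (\<eta> x y) + 2 * bf (h x) (\<eta> x y) (DW x (\<eta> x y))"
    by (simp add: R_def h_comm[OF x, of "DW x (\<eta> x y)"])
  have "2 * bf (h x) (\<eta> x y) (Gv x y) = P x y (\<eta> x y) - R x (\<eta> x y) (\<eta> x y) * F x y"
    using h_Gv[OF x, of y "\<eta> x y"] F h_comm[OF x, of "Gv x y" "\<eta> x y"]
    by (simp add: navigation x power2_eq_square)
  moreover have "cc x y * phi x y y = P x y (\<eta> x y) - R x (\<eta> x y) (\<eta> x y) * F x y"
  proof -
    have "2 * (P x y (\<eta> x y) - R x (\<eta> x y) (\<eta> x y) * F x y) = 2 * P x y (\<eta> x y) - F x y * (2 * R x (\<eta> x y) (\<eta> x y))"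
      by simp
    also have "\<dots> = 2 * (cc x y * phi x y y)"
      unfolding cc_phi R P_def Dh_y DW_y by (simp add: algebra_simps)
    finally show ?thesis by simp
  qed
  ultimately have "cc x y * (phi x y y - 2 * ell x y (Gv x y)) = 0"
    by (simp add: algebra_simps cc_ell)
  then show ?thesis
    using cc_pos[OF x y] ell_lin(3)[of x y "-2" "Gv x y"] by (simp add: dF_def)
qed

lemma d\<eta>_geodesic: "d\<eta> x y y (- 2 *\<^sub>R Gv x y) = - 2 *\<^sub>R Gv x y - F x y *\<^sub>R DW x y"
  unfolding d\<eta>_def dF_geodesic by simp

lemma h\<eta>_geodesic:
  "bf (Dh x y) (\<eta> x y) Z + bf (h x) (d\<eta> x y y (- 2 *\<^sub>R Gv x y)) Z
    = cc x y * phi x y Z + R x (\<eta> x y) (\<eta> x y) * cc x y * ell x y Z / F x y"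
proof -
  have "bf (h x) (d\<eta> x y y (- 2 *\<^sub>R Gv x y)) Z = - (2 * bf (h x) (Gv x y) Z) - F x y * bf (h x) Z (DW x y)"
    unfolding d\<eta>_geodesic using h_comm[OF x, of Z "DW x y"] by simp
  then show ?thesis
    unfolding h_Gv[OF x] cc_phi P_def mult.assoc cc_ell by simp
qed

text \<open>Since \<open>cc - F\<close> is h(\<eta>, W), the preceding identity tested on
  \<open>W\<close> gives its rate of change; the terms in \<open>phi\<close> and \<open>DW\<close>
  add up to exactly R(\<eta>, \<eta>).\<close>

lemma dcc_geodesic: "dcc x y y (- 2 *\<^sub>R Gv x y) = R x (\<eta> x y) (\<eta> x y) * cc x y / F x y"
proof -
  have F: "F x y \<noteq> 0" using F_pos[OF x y] by simp
  have 1: "dcc x y y (- 2 *\<^sub>R Gv x y) = cc x y * phi x y (W x) + bf (h x) (\<eta> x y) (DW x y)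
      + R x (\<eta> x y) (\<eta> x y) * (cc x y - F x y) / F x y"
    unfolding dcc_def dF_geodesic ell_y(3)[OF x y, symmetric]
    using h\<eta>_geodesic[of "W x"] by (simp add: algebra_simps)
  have 2: "cc x y * phi x y (W x) + bf (h x) (\<eta> x y) (DW x y) = R x (\<eta> x y) (\<eta> x y)"
    unfolding cc_phi DW_y R_def using h_comm[OF x, of "DW x (\<eta> x y)" "\<eta> x y"] by simp
  show ?thesis unfolding 1 2 using F by (simp add: field_simps)
qed

lemma dell_geodesic: "dell x y y (- 2 *\<^sub>R Gv x y) Z = phi x y Z"
proof -
  have c: "cc x y \<noteq> 0" using cc_pos[OF x y] by simp
  have "dell x y y (- 2 *\<^sub>R Gv x y) Z = cc x y * phi x y Z / cc x y"
    unfolding dell_def h\<eta>_geodesic dcc_geodesic by simp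
  then show ?thesis using c by simp
qed

text \<open>Both geodesic identities split by linearity into a base part and a fibre part, and the
  fibre parts are what g(G, Z) is made of. The right-hand side is, up to a factor, the covector from
  which \<open>spray\<close> is computed.\<close>

lemma gm_Gv: "2 * gm x y (Gv x y) Z = ell x y Z * phi x y y + F x y * (dell x y y 0 Z - phi x y Z)"
proof -
  have "dell x y 0 (- 2 *\<^sub>R Gv x y) Z = - 2 * dell x y 0 (Gv x y) Z"
    using dell_lin(2)[OF x, of y "-2" 0 "Gv x y" Z] by simp
  then have "dell x y y 0 Z - phi x y Z = 2 * dell x y 0 (Gv x y) Z"
    using dell_geodesic[of Z] dell_split[OF x, of y y "- 2 *\<^sub>R Gv x y" Z] by simp
  moreover have "phi x y y = 2 * ell x y (Gv x y)"
    using dF_geodesic ell_lin(3)[of x y "-2" "Gv x y"] by (simp add: dF_def)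
  ultimately show ?thesis by (simp add: gm_def)
qed

end

lemma spray_eq:
  assumes x: "x \<in> U" and y: "y \<noteq> 0"
  shows "spray F i x y = Gv x y $ i"
proof -
  define r where "r = (\<chi> l. (\<Sum>k\<in>UNIV. partial l (\<lambda>z. partial k (\<lambda>x'. (F x' z)\<^sup>2) x) y * y $ k)
       - partial l (\<lambda>x'. (F x' y)\<^sup>2) x)"
  note d = has_derivative_const has_derivative_ident x y
  \<comment> \<open>The bracket in \<open>spray\<close> is 4 g(G, .), which accounts for the 1/4 in
    front of it.\<close>
  have "r $ l = 4 * gm x y (Gv x y) (axis l 1)" for l
  proof -
    let ?e = "axis l 1 :: real^'n"
    have "partial l (\<lambda>z. partial k (\<lambda>x'. (F x' z)\<^sup>2) x) y
        = 2 * (ell x y ?e * phi x y (axis k 1) + F x y * dell x y (axis k 1) 0 ?e)" for k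
    proof -
      have "((\<lambda>z. 2 * F x z * phi x z (axis k 1)) has_derivative
        (\<lambda>b. 2 * (ell x y b * phi x y (axis k 1) + F x y * dell x y (axis k 1) 0 b))) (at y)"
        by (rule derivative_eq_intros has_derivative_F[OF d] has_derivative_phi[OF x y] refl)+
           (simp add: x fun_eq_iff dphi_eq_dell algebra_simps)
      then have "((\<lambda>z. partial k (\<lambda>x'. (F x' z)\<^sup>2) x) has_derivative
        (\<lambda>b. 2 * (ell x y b * phi x y (axis k 1) + F x y * dell x y (axis k 1) 0 b))) (at y)"
        by (rule has_derivative_transform_within_open[OF _ open_nonzero])
           (use y in \<open>auto simp: partial_eq[OF has_derivative_F2_x[OF x]]\<close>)
      then show ?thesis by (rule partial_eq)
    qed
    then have "r $ l = 2 * (ell x y ?e * (\<Sum>k\<in>UNIV. y $ k * phi x y (axis k 1))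
        + F x y * (\<Sum>k\<in>UNIV. y $ k * dell x y (axis k 1) 0 ?e)) - 2 * F x y * phi x y ?e"
      unfolding r_def partial_eq[OF has_derivative_F2_x[OF x y]]
      by (simp add: sum.distrib sum_distrib_left algebra_simps)
    also have "\<dots> = 2 * (ell x y ?e * phi x y y + F x y * dell x y y 0 ?e) - 2 * F x y * phi x y ?e"
      using linear_expand[OF phi_linear[OF x], of y y]
        linear_expand[OF dell_linear(1)[OF x, of y ?e], of y] by simp
    also have "\<dots> = 4 * gm x y (Gv x y) ?e"
      using gm_Gv[OF x y, of ?e] by (simp add: algebra_simps)
    finally show ?thesis .
  qed
  then have "r = 4 *\<^sub>R (fund F x y *v Gv x y)"
    by (simp add: vec_eq_iff bf_axis_left[symmetric] bf_fund[OF x y] gm_comm[OF x, of y "Gv x y"])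
  then have "matrix_inv (fund F x y) *v r = 4 *\<^sub>R Gv x y"
    using matrix_inv_apply(1)[OF fund_invertible[OF x y]] by (simp add: matrix_vector_mult_scaleR)
  moreover have "spray F i x y = (matrix_inv (fund F x y) *v r) $ i / 4"
    by (simp add: spray_def r_def matrix_vector_mult_def)
  ultimately show ?thesis by simp
qed

end

section \<open>Nonlinear connection and Chern connection\<close>

lemma has_derivative_vec_lambda:
  fixes f :: "'i::finite \<Rightarrow> 'a::real_normed_vector \<Rightarrow> real"
  assumes "\<And>i. (f i has_derivative f' i) (at x within S)"
  shows "((\<lambda>x. \<chi> i. f i x) has_derivative (\<lambda>d. \<chi> i. f' i d)) (at x within S)"
  using assms by (subst has_derivative_componentwise_within) (auto simp: Basis_vec_def inner_axis)

lemma has_derivative_component: 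
  "(f has_derivative f') (at x within S) \<Longrightarrow> ((\<lambda>x. f x $ i) has_derivative (\<lambda>d. f' d $ i)) (at x within S)"
  by (rule bounded_linear.has_derivative[OF bounded_linear_vec_nth])

lemma matrix_inv_commute:
  fixes A :: "real^'n^'n"
  assumes "invertible A" "transpose A = A" shows "matrix_inv A $ i $ j = matrix_inv A $ j $ i"
proof -
  have "bf (matrix_inv A) u v = bf A (matrix_inv A *v u) (matrix_inv A *v v)" for u v
  proof -
    have "bf A (matrix_inv A *v u) (matrix_inv A *v v) = (matrix_inv A *v u) \<bullet> v"
      unfolding bf_def by (simp add: matrix_inv_apply assms)
    moreover have "bf A (matrix_inv A *v v) (matrix_inv A *v u) = (matrix_inv A *v v) \<bullet> u"
      unfolding bf_def by (simp add: matrix_inv_apply assms)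
    ultimately show ?thesis using bf_commute[OF assms(2)] by (metis bf_def inner_commute)
  qed
  then show ?thesis by (metis bf_axis bf_commute[OF assms(2)])
qed

context randers_data
begin

section \<open>Traces with respect to h\<close>

definition "tr x T = (\<Sum>i\<in>UNIV. \<Sum>l\<in>UNIV. matrix_inv (h x) $ i $ l * T (axis i 1) (axis l 1))"

lemma tr_add: "tr x (\<lambda>b Z. S b Z + T b Z) = tr x S + tr x T"
  by (simp add: tr_def algebra_simps sum.distrib)

lemma tr_scale: "tr x (\<lambda>b Z. r * T b Z) = r * tr x T"
  by (simp add: tr_def algebra_simps sum_distrib_left)

lemma tr_swap:
  assumes x: "x \<in> U" shows "tr x (\<lambda>b Z. T Z b) = tr x T"
  unfolding tr_def
  by (subst sum.swap) (simp add: matrix_inv_commute[OF h_invertible[OF x] h_sym[OF x], of _ "_::'n"]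
      cong: sum.cong)

lemma tr_antisym:
  assumes x: "x \<in> U" and T: "\<And>b Z. T b Z = - T Z b" shows "tr x T = 0"
proof -
  have "(\<lambda>b Z. T Z b) = (\<lambda>b Z. - 1 * T b Z)"
  proof (intro ext)
    fix b Z show "T Z b = - 1 * T b Z" using T[of Z b] by simp
  qed
  then have "tr x (\<lambda>b Z. T Z b) = tr x (\<lambda>b Z. - 1 * T b Z)" by (rule arg_cong)
  then show ?thesis using tr_swap[OF x, of T] tr_scale[of x "- 1" T] by linarith
qed

lemma tr_h_left:
  assumes x: "x \<in> U" and "linear \<alpha>" shows "tr x (\<lambda>b Z. bf (h x) u b * \<alpha> Z) = \<alpha> u"
proof -
  have "tr x (\<lambda>b Z. bf (h x) u b * \<alpha> Z) =
      (\<Sum>l\<in>UNIV. (matrix_inv (h x) *v (h x *v u)) $ l * \<alpha> (axis l 1))"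
    unfolding tr_def
    by (subst sum.swap) (simp add: matrix_vector_mult_def[of "matrix_inv (h x)"] bf_axis_left
        h_comm[OF x, of u] sum_distrib_right sum_distrib_left matrix_inv_commute[OF h_invertible[OF x] h_sym[OF x]]
        algebra_simps cong: sum.cong)
  then show ?thesis
    using linear_expand[OF assms(2), of u] by (simp add: matrix_inv_apply h_invertible x)
qed

lemma tr_h_right:
  assumes x: "x \<in> U" and "linear \<alpha>" shows "tr x (\<lambda>b Z. bf (h x) u Z * \<alpha> b) = \<alpha> u"
  using tr_swap[OF x, of "\<lambda>b Z. bf (h x) u b * \<alpha> Z"] tr_h_left[OF assms] by simp

lemma tr_h: "x \<in> U \<Longrightarrow> tr x (bf (h x)) = CARD('n)"
proof -
  assume x: "x \<in> U"
  have "tr x (bf (h x)) = (\<Sum>i\<in>UNIV. (matrix_inv (h x) *v (h x *v axis i 1)) $ i)"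
    unfolding tr_def bf_axis
    by (simp add: matrix_vector_mult_def[of "matrix_inv (h x)"] matrix_vector_mult_basis column_def
        bf_axis[symmetric] h_comm[OF x] cong: sum.cong)
  then show ?thesis by (simp add: matrix_inv_apply h_invertible x)
qed

section \<open>The fibre derivative of the spray and its trace\<close>

definition "dP x y b Z = bf (Dh x b) (\<eta> x y) Z + bf (Dh x y) (d\<eta> x y 0 b) Z
  - ell x y b * bf (h x) Z (DW x y) - F x y * bf (h x) Z (DW x b)
  - bf (Dh x Z) (\<eta> x y) (d\<eta> x y 0 b)
  + ell x y b * bf (h x) (\<eta> x y) (DW x Z) + F x y * bf (h x) (d\<eta> x y 0 b) (DW x Z)"

definition "dQ x y b Z = dP x y b Z
  - (2 * R x (\<eta> x y) (d\<eta> x y 0 b) * bf (h x) (\<eta> x y) Z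
    + R x (\<eta> x y) (\<eta> x y) * bf (h x) (d\<eta> x y 0 b) Z) / F x y
  + R x (\<eta> x y) (\<eta> x y) * bf (h x) (\<eta> x y) Z * ell x y b / (F x y)\<^sup>2"

definition "dGv x y b = matrix_inv (h x) *v (\<chi> i. dQ x y b (axis i 1) / 2)"

lemma d\<eta>_fibre: "x \<in> U \<Longrightarrow> d\<eta> x y 0 b = b - ell x y b *\<^sub>R W x"
  by (simp add: d\<eta>_def dF_def DW_lin)

lemma R_matrix: "x \<in> U \<Longrightarrow> bf (\<chi> i j. R x (axis i 1) (axis j 1)) X Y = R x X Y"
  by (rule bf_of_bilinear) (auto intro!: linearI simp: R_lin)

lemma has_derivative_Gv:
  assumes x: "x \<in> U" and y: "y \<noteq> 0"
  shows "(Gv x has_derivative dGv x y) (at y)"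
proof -
  note d = has_derivative_const has_derivative_ident x y
  note e = has_derivative_\<eta>[OF d]
  have F': "(F x has_derivative ell x y) (at y)"
    using has_derivative_F[OF d] by (simp add: x)
  have F0: "F x y \<noteq> 0" using F_pos[OF x y] by simp
  define RM where "RM = (\<chi> i j. R x (axis i 1) (axis j 1))"
  have RM: "bf RM X Y = R x X Y" for X Y by (simp add: RM_def R_matrix[OF x])
  have DhC: "((\<lambda>y. Dh x y) has_derivative Dh x) (at y)"
    by (rule linear_imp_has_derivative[OF Dh_linear[OF x]])
  have DWC: "((\<lambda>y. DW x y) has_derivative DW x) (at y)"
    by (rule linear_imp_has_derivative[OF DW_linear[OF x]])
  have P': "((\<lambda>y. P x y Z) has_derivative (\<lambda>b. dP x y b Z)) (at y)" for Z
  proof -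
    note has_derivative_bf[OF has_derivative_const e e, of "Dh x Z"]
    then have 1: "((\<lambda>y. bf (Dh x Z) (\<eta> x y) (\<eta> x y) / 2) has_derivative
        (\<lambda>b. bf (Dh x Z) (\<eta> x y) (d\<eta> x y 0 b))) (at y)"
      by (rule has_derivative_eq_rhs[OF has_derivative_divide'[OF _ has_derivative_const]])
         (use Dh_comm[OF x, of Z "d\<eta> x y 0 _" "\<eta> x y"] in \<open>simp_all add: fun_eq_iff\<close>)
    show ?thesis unfolding P_def
      by (rule has_derivative_eq_rhs[OF has_derivative_add[OF has_derivative_diff[OF has_derivative_diff[OF
            has_derivative_bf[OF DhC e has_derivative_const]
            has_derivative_mult[OF F' has_derivative_bf[OF has_derivative_const has_derivative_const DWC]]]
            1] has_derivative_mult[OF F' has_derivative_bf[OF has_derivative_const e has_derivative_const]]]])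
         (simp add: fun_eq_iff dP_def)
  qed
  have R': "((\<lambda>y. R x (\<eta> x y) (\<eta> x y)) has_derivative (\<lambda>b. 2 * R x (\<eta> x y) (d\<eta> x y 0 b))) (at y)"
    unfolding RM[symmetric]
    by (rule has_derivative_eq_rhs[OF has_derivative_bf[OF has_derivative_const e e]])
       (use R_comm[OF x, of "d\<eta> x y 0 _" "\<eta> x y"] in \<open>simp add: fun_eq_iff RM\<close>)
  have "((\<lambda>y. P x y Z - R x (\<eta> x y) (\<eta> x y) * bf (h x) (\<eta> x y) Z / F x y) has_derivative
      (\<lambda>b. dQ x y b Z)) (at y)" for Z
    by (rule has_derivative_eq_rhs[OF has_derivative_diff[OF P' has_derivative_divide'[OF
            has_derivative_mult[OF R' has_derivative_bf[OF has_derivative_const e has_derivative_const]] F' F0]]])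
       (use F0 in \<open>simp add: fun_eq_iff dQ_def field_simps power2_eq_square\<close>)
  then have "((\<lambda>y. (P x y Z - R x (\<eta> x y) (\<eta> x y) * bf (h x) (\<eta> x y) Z / F x y) / 2) has_derivative
      (\<lambda>b. dQ x y b Z / 2)) (at y)" for Z
    by (rule has_derivative_eq_rhs[OF has_derivative_divide'[OF _ has_derivative_const]])
       (simp_all add: fun_eq_iff)
  from bounded_linear.has_derivative[OF matrix_vector_mul_bounded_linear has_derivative_vec_lambda[OF this]]
  show ?thesis unfolding Gv_def dGv_def .
qed

lemma dGv_linear: "x \<in> U \<Longrightarrow> y \<noteq> 0 \<Longrightarrow> linear (dGv x y)"
  using has_derivative_Gv has_derivative_linear by blast

text \<open>Euler's relation for the 2-homogeneous spray. It identifies the horizontal lift of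
  \<open>y\<close> with (y, -2G), to which the Euler-Lagrange identities apply.\<close>

lemma dGv_homogeneous:
  assumes x: "x \<in> U" and y: "y \<noteq> 0"
  shows "dGv x y y = 2 *\<^sub>R Gv x y"
proof -
  have F0: "F x y \<noteq> 0" using F_pos[OF x y] by simp
  have e: "d\<eta> x y 0 y = \<eta> x y" by (simp add: d\<eta>_fibre[OF x] ell_y[OF x y] \<eta>_def)
  have "dP x y y Z = 2 * P x y Z" for Z
    by (simp add: dP_def P_def e ell_y[OF x y])
  then have "dQ x y y Z = 2 * (P x y Z - R x (\<eta> x y) (\<eta> x y) * bf (h x) (\<eta> x y) Z / F x y)" for Z
    using F0 by (simp add: dQ_def e ell_y[OF x y] power2_eq_square)
  then have "(\<chi> i. dQ x y y (axis i 1) / 2) = 2 *\<^sub>R (\<chi> i. (P x y (axis i 1)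
     - R x (\<eta> x y) (\<eta> x y) * bf (h x) (\<eta> x y) (axis i 1) / F x y) / 2)"
    by (simp add: vec_eq_iff)
  then show ?thesis by (simp only: dGv_def Gv_def matrix_vector_mult_scaleR)
qed

lemma nonlin_conn_eq:
  assumes x: "x \<in> U" and y: "y \<noteq> 0"
  shows "nonlin_conn F i j x y = dGv x y (axis j 1) $ i"
proof -
  have "(spray F i x has_derivative (\<lambda>b. dGv x y b $ i)) (at y)"
    by (rule has_derivative_transform_within_open[OF has_derivative_component[OF has_derivative_Gv[OF x y]]
          open_nonzero]) (use y in \<open>auto simp: spray_eq[OF x]\<close>)
  then show ?thesis unfolding nonlin_conn_def by (rule partial_eq)
qed

text \<open>The form \<open>dQ\<close> splits into an antisymmetric part of trace zero, the form
  \<open>Dh x y\<close>, two rank-one forms built on h(\<eta>, .), and a multiple of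
  \<open>h\<close>. In the factor n + 1 the multiple of \<open>h\<close> accounts for n and the
  rank-one forms together for 1.\<close>

lemma trace_dGv:
  assumes x: "x \<in> U" and y: "y \<noteq> 0"
  shows "2 * (\<Sum>i\<in>UNIV. dGv x y (axis i 1) $ i)
    = tr x (bf (Dh x y)) - (real CARD('n) + 1) * R x (\<eta> x y) (\<eta> x y) / F x y"
proof -
  have F0: "F x y \<noteq> 0" using F_pos[OF x y] by simp
  have c: "cc x y \<noteq> 0" using cc_pos[OF x y] by simp
  define f where "f = F x y"
  define c0 where "c0 = cc x y"
  define E where "E = \<eta> x y"
  define R0 where "R0 = R x E E"
  note fold = f_def[symmetric] c0_def[symmetric] E_def[symmetric] R0_def[symmetric]
  have f0: "f \<noteq> 0" and c0: "c0 \<noteq> 0" using F0 c by (simp_all add: f_def c0_def)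
  define A where "A b Z = bf (Dh x b) E Z - bf (Dh x Z) E b
    + f * (bf (h x) b (DW x Z) - bf (h x) Z (DW x b))" for b Z
  \<comment> \<open>\<open>\<beta>\<close> gathers what is multiplied by \<open>ell x y b\<close>,
    that is h(E, b) / c0, and \<open>\<gamma>\<close> what is multiplied by h(E, Z).\<close>
  define \<beta> where "\<beta> Z = (- bf (Dh x y) (W x) Z - bf (h x) Z (DW x y) + bf (Dh x Z) E (W x)
    + bf (h x) E (DW x Z) - f * bf (h x) (W x) (DW x Z)) / c0 + R0 * bf (h x) (W x) Z / (c0 * f)" for Z
  define \<gamma> where "\<gamma> b = - 2 * R x E b / f + 2 * R x E (W x) * bf (h x) E b / (c0 * f)
     + R0 * bf (h x) E b / (c0 * f\<^sup>2)" for b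
  have \<beta>: "linear \<beta>" and \<gamma>: "linear \<gamma>"
    by (auto intro!: linearI simp: \<beta>_def \<gamma>_def Dh_lin[OF x] DW_lin[OF x] R_lin[OF x]
        add_divide_distrib diff_divide_distrib algebra_simps)
  have dQ: "dQ x y b Z = A b Z + (bf (Dh x y) b Z + (bf (h x) E b * \<beta> Z
      + (bf (h x) E Z * \<gamma> b + (- R0 / f) * bf (h x) b Z)))" for b Z
    unfolding dQ_def dP_def d\<eta>_fibre[OF x] fold ell_def A_def \<beta>_def \<gamma>_def
    using f0 c0 R_lin(5)[OF x, of E b] R_lin(4)[OF x, of E _ "W x"] R_comm[OF x]
    by (simp add: R_lin[OF x] divide_simps) (simp add: algebra_simps power2_eq_square)
  have A: "tr x A = 0" by (rule tr_antisym[OF x]) (simp add: A_def algebra_simps)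
  have dQ2: "tr x (\<lambda>b Z. dQ x y b Z) = tr x (bf (Dh x y)) + \<beta> E + \<gamma> E - R0 / f * CARD('n)"
    unfolding dQ tr_add tr_scale tr_h_left[OF x \<beta>] tr_h_right[OF x \<gamma>] tr_h[OF x]
    using A by simp
  have nav: "bf (h x) E E = f\<^sup>2" unfolding E_def f_def by (rule navigation[OF x])
  have hW: "bf (h x) (W x) E = c0 - f"
    unfolding c0_def cc_def fold by (simp add: h_comm[OF x, of E])
  have "\<beta> E = - 2 * f * R x E (W x) / c0 + R0 * (c0 - f) / (c0 * f)"
  proof -
    have "- bf (Dh x y) (W x) E - bf (h x) E (DW x y) + bf (Dh x E) E (W x)
      + bf (h x) E (DW x E) - f * bf (h x) (W x) (DW x E) = - 2 * f * R x E (W x)"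
      unfolding Dh_y[OF x y] DW_y[OF x y] fold R_def
      by (simp add: Dh_comm[OF x, of _ E "W x"] h_comm[OF x, of "DW x E" "W x"] algebra_simps)
    then show ?thesis by (simp only: \<beta>_def hW)
  qed
  moreover have "\<gamma> E = - 2 * R0 / f + 2 * R x E (W x) * f / c0 + R0 / c0"
    using f0 by (simp add: \<gamma>_def nav R0_def power2_eq_square)
  \<comment> \<open>The contributions of R(E, W), abstracted to \<open>r\<close>, cancel between
    \<open>\<beta>\<close> and \<open>\<gamma>\<close>.\<close>
  moreover have "(- 2 * f * r / c0 + R0 * (c0 - f) / (c0 * f)) + (- 2 * R0 / f + 2 * r * f / c0 + R0 / c0)
      = - R0 / f" for r
    using f0 c0 by (simp add: divide_simps) (simp add: algebra_simps)
  ultimately have "\<beta> E + \<gamma> E = - R0 / f" by simp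
  then have "tr x (\<lambda>b Z. dQ x y b Z) = tr x (bf (Dh x y)) - (real CARD('n) + 1) * R0 / f"
    unfolding dQ2 by (simp add: algebra_simps add_divide_distrib)
  moreover have "2 * (\<Sum>i\<in>UNIV. dGv x y (axis i 1) $ i) = tr x (\<lambda>b Z. dQ x y b Z)"
    by (simp add: tr_def dGv_def matrix_vector_mult_def sum_distrib_left)
  ultimately show ?thesis by (simp add: fold)
qed

end

text \<open>The Koszul formula, for the trilinear form \<open>H a Y Z\<close> of the derivatives in direction \<open>a\<close> of the metric.\<close>

lemma christoffel_lowered:
  fixes A :: "real^'n^'n" and X V Z :: "real^'n"
  assumes A: "invertible A"
    and H: "\<And>Y Z. linear (\<lambda>a. H a Y Z)" "\<And>a Z. linear (\<lambda>Y. H a Y Z)" "\<And>a Y. linear (H a Y)"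
  shows "2 * bf A Z (\<chi> i. \<Sum>j\<in>UNIV. \<Sum>k\<in>UNIV. 1/2 * (\<Sum>l\<in>UNIV. matrix_inv A $ i $ l *
      (H (axis j 1) (axis l 1) (axis k 1) + H (axis k 1) (axis j 1) (axis l 1)
        - H (axis l 1) (axis j 1) (axis k 1))) * X $ j * V $ k)
    = H X Z V + H V X Z - H Z X V" (is "2 * bf A Z ?C = _")
proof -
  define T where "T j k l = H (axis j 1) (axis l 1) (axis k 1)
      + H (axis k 1) (axis j 1) (axis l 1) - H (axis l 1) (axis j 1) (axis k 1)" for j k l
  define T3 where "T3 = (\<chi> l. \<Sum>j\<in>UNIV. \<Sum>k\<in>UNIV. T j k l * X $ j * V $ k)"
  define g where "g i l = matrix_inv A $ i $ l" for i l
  have "?C $ i = (matrix_inv A *v ((1/2) *\<^sub>R T3)) $ i" for i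
  proof -
    have "?C $ i = (\<Sum>j\<in>UNIV. \<Sum>k\<in>UNIV. \<Sum>l\<in>UNIV. g i l * (1/2 * (T j k l * X $ j * V $ k)))"
      by (simp add: T_def[symmetric] g_def[symmetric] sum_distrib_left sum_distrib_right ac_simps)
    also have "\<dots> = (\<Sum>j\<in>UNIV. \<Sum>l\<in>UNIV. \<Sum>k\<in>UNIV. g i l * (1/2 * (T j k l * X $ j * V $ k)))"
      by (rule sum.cong[OF refl], rule sum.swap)
    also have "\<dots> = (\<Sum>l\<in>UNIV. \<Sum>j\<in>UNIV. \<Sum>k\<in>UNIV. g i l * (1/2 * (T j k l * X $ j * V $ k)))"
      by (rule sum.swap)
    also have "\<dots> = (matrix_inv A *v ((1/2) *\<^sub>R T3)) $ i"
      by (simp add: matrix_vector_mult_def T3_def sum_distrib_left g_def)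
    finally show ?thesis .
  qed
  then have "?C = matrix_inv A *v ((1/2) *\<^sub>R T3)" unfolding vec_eq_iff by blast
  then have C: "A *v ?C = (1/2) *\<^sub>R T3"
    by (simp only: matrix_inv_apply(2)[OF A])
  have T3: "T3 $ l = H X (axis l 1) V + H V X (axis l 1) - H (axis l 1) X V" for l
  proof -
    have e: "H X Y V = (\<Sum>j\<in>UNIV. \<Sum>k\<in>UNIV. X $ j * V $ k * H (axis j 1) Y (axis k 1))" for Y
      by (subst linear_expand[OF H(1)], subst linear_expand[OF H(3)])
         (simp add: sum_distrib_left algebra_simps)
    have e2: "H V X Y = (\<Sum>j\<in>UNIV. \<Sum>k\<in>UNIV. X $ j * V $ k * H (axis k 1) (axis j 1) Y)" for Y
      by (subst linear_expand[OF H(2)], subst linear_expand[OF H(1)])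
         (simp add: sum_distrib_left algebra_simps)
    have e3: "H Y X V = (\<Sum>j\<in>UNIV. \<Sum>k\<in>UNIV. X $ j * V $ k * H Y (axis j 1) (axis k 1))" for Y
      by (subst linear_expand[OF H(2)], subst linear_expand[OF H(3)])
         (simp add: sum_distrib_left algebra_simps)
    show ?thesis
      unfolding e e2 e3[of "axis l 1"] T3_def T_def
      by (simp add: algebra_simps sum.distrib sum_subtractf)
  qed
  have "2 * bf A Z ?C = (\<Sum>l\<in>UNIV. Z $ l * T3 $ l)"
    unfolding bf_def C by (simp add: inner_vec_def sum_distrib_left)
  also have "\<dots> = H X Z V + H V X Z - H Z X V"
  proof -
    have "linear (\<lambda>Z. H X Z V + H V X Z - H Z X V)"
      using H by (intro linear_compose_add linear_compose_sub)
    from linear_expand[OF this, of Z] show ?thesis unfolding T3 by simp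
  qed
  finally show ?thesis .
qed

section \<open>Horizontal derivatives and the Chern coefficients\<close>

context randers_data
begin

text \<open>Derivative of \<open>gm\<close>, with fixed arguments \<open>Y\<close> and \<open>Z\<close>, at \<open>(x, y)\<close> in the direction \<open>(a, b)\<close>.\<close>

definition "gE x y Y Z = bf (h x) Y Z - ell x y Y * bf (h x) (W x) Z - ell x y Z * bf (h x) (W x) Y
  - ell x y Y * ell x y Z * (1 - bf (h x) (W x) (W x))"

definition "dgE x y a b Y Z = bf (Dh x a) Y Z
  - dell x y a b Y * bf (h x) (W x) Z - ell x y Y * (bf (Dh x a) (W x) Z + bf (h x) (DW x a) Z)
  - dell x y a b Z * bf (h x) (W x) Y - ell x y Z * (bf (Dh x a) (W x) Y + bf (h x) (DW x a) Y)
  - (dell x y a b Y * ell x y Z + ell x y Y * dell x y a b Z) * (1 - bf (h x) (W x) (W x))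
  + ell x y Y * ell x y Z * (bf (Dh x a) (W x) (W x) + bf (h x) (DW x a) (W x) + bf (h x) (W x) (DW x a))"

definition "dgm x y a b Y Z = dell x y a b Y * ell x y Z + ell x y Y * dell x y a b Z
  + (dF x y a b * cc x y - F x y * dcc x y a b) / (cc x y * cc x y) * gE x y Y Z
  + F x y / cc x y * dgE x y a b Y Z"

text \<open>In this form the tensor is algebraic in \<open>h\<close>, \<open>W\<close>,
  \<open>F\<close>, \<open>cc\<close> and \<open>ell\<close>, so the first derivatives already known
  suffice to differentiate it, and \<open>dell\<close> need not be differentiated again.\<close>

lemma gm_gE: "x \<in> U \<Longrightarrow> gm x y Y Z = ell x y Y * ell x y Z + F x y / cc x y * gE x y Y Z"
  by (simp add: gm_eq gE_def)

lemma has_derivative_gm: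
  assumes X: "(X has_derivative X') (at t)" and Y: "(Y has_derivative Y') (at t)"
    and V: "(V has_derivative V') (at t)" and x: "X t \<in> U" and y: "Y t \<noteq> 0"
  shows "((\<lambda>t. gm (X t) (Y t) (V t) Z) has_derivative
    (\<lambda>d. dgm (X t) (Y t) (X' d) (Y' d) (V t) Z + gm (X t) (Y t) (V' d) Z)) (at t)"
proof -
  note d = X Y x y
  have c: "cc (X t) (Y t) \<noteq> 0" using cc_pos[OF x y] by simp
  note lV = has_derivative_ell[OF d V] and lZ = has_derivative_ell[OF d has_derivative_const[of Z]]
  note h' = has_derivative_h[OF d] and W' = has_derivative_W[OF d]
  have Z: "((\<lambda>t. Z) has_derivative (\<lambda>d. 0)) (at t)" by simp
  have E: "((\<lambda>t. gE (X t) (Y t) (V t) Z) has_derivative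
      (\<lambda>d. dgE (X t) (Y t) (X' d) (Y' d) (V t) Z + gE (X t) (Y t) (V' d) Z)) (at t)"
    unfolding gE_def
    by (rule has_derivative_eq_rhs[OF has_derivative_diff[OF has_derivative_diff[OF has_derivative_diff[OF
          has_derivative_bf[OF h' V Z]
          has_derivative_mult[OF lV has_derivative_bf[OF h' W' Z]]]
          has_derivative_mult[OF lZ has_derivative_bf[OF h' W' V]]]
          has_derivative_mult[OF has_derivative_mult[OF lV lZ]
            has_derivative_diff[OF has_derivative_const has_derivative_bf[OF h' W' W']]]]])
       (simp add: fun_eq_iff dgE_def gE_def algebra_simps)
  have "((\<lambda>t. ell (X t) (Y t) (V t) * ell (X t) (Y t) Z
      + F (X t) (Y t) / cc (X t) (Y t) * gE (X t) (Y t) (V t) Z) has_derivative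
    (\<lambda>d. dgm (X t) (Y t) (X' d) (Y' d) (V t) Z + gm (X t) (Y t) (V' d) Z)) (at t)"
    by (rule has_derivative_eq_rhs[OF has_derivative_add[OF has_derivative_mult[OF lV lZ]
          has_derivative_mult[OF has_derivative_divide'[OF has_derivative_dF[OF d] has_derivative_cc[OF d] c] E]]])
       (simp add: fun_eq_iff dgm_def gm_gE[OF x] algebra_simps)
  then show ?thesis
  proof (rule has_derivative_transform_eventually)
    have "\<forall>\<^sub>F s in at t. X s \<in> U"
      by (rule topological_tendstoD[OF isContD[OF has_derivative_continuous[OF X]] open_U x])
    then show "\<forall>\<^sub>F s in at t. ell (X s) (Y s) (V s) * ell (X s) (Y s) Z
      + F (X s) (Y s) / cc (X s) (Y s) * gE (X s) (Y s) (V s) Z = gm (X s) (Y s) (V s) Z"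
      by eventually_elim (simp add: gm_gE)
  qed (simp_all add: gm_gE[OF x])
qed

lemma dgm_comm: "x \<in> U \<Longrightarrow> dgm x y a b Y Z = dgm x y a b Z Y"
  by (simp add: dgm_def gE_def dgE_def h_comm[of x Y Z] Dh_comm[of x a Y Z] algebra_simps)

lemma dgm_lin:
  assumes x: "x \<in> U"
  shows "dgm x y (a + a') (b + b') Y Z = dgm x y a b Y Z + dgm x y a' b' Y Z"
    "dgm x y (r *\<^sub>R a) (r *\<^sub>R b) Y Z = r * dgm x y a b Y Z"
    "dgm x y a b (Y + Y') Z = dgm x y a b Y Z + dgm x y a b Y' Z"
    "dgm x y a b (r *\<^sub>R Y) Z = r * dgm x y a b Y Z"
  by (simp_all add: dgm_def gE_def dgE_def dell_lin[OF x] dF_lin[OF x] dcc_lin[OF x] ell_lin Dh_lin[OF x]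
      DW_lin[OF x] add_divide_distrib diff_divide_distrib algebra_simps)

text \<open>The derivative of g along the horizontal lift of \<open>a\<close>;
  \<open>dGv x y a\<close> is the nonlinear connection applied to \<open>a\<close>.\<close>

definition "hor x y a Y Z = dgm x y a (- dGv x y a) Y Z"

context
  fixes x y :: "real^'n" assumes x: "x \<in> U" and y: "y \<noteq> 0"
begin

lemma partial_fund_x: "partial j (\<lambda>x'. fund F x' y $ l $ k) x = dgm x y (axis j 1) 0 (axis l 1) (axis k 1)"
proof (rule partial_eq)
  have "((\<lambda>x. gm x y (axis l 1) (axis k 1)) has_derivative (\<lambda>a. dgm x y a 0 (axis l 1) (axis k 1))) (at x)"
    using has_derivative_gm[OF has_derivative_ident has_derivative_const has_derivative_const x y]
    by (simp add: gm_def ell_lin dell_def d\<eta>_fibre dcc_def dF_def x DW_lin Dh_lin)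
  then show "((\<lambda>x'. fund F x' y $ l $ k) has_derivative (\<lambda>a. dgm x y a 0 (axis l 1) (axis k 1))) (at x)"
    by (rule has_derivative_transform_within_open[OF _ open_U x]) (simp add: fund_component y)
qed

lemma partial_fund_y: "partial m (\<lambda>y. fund F x y $ l $ k) y = dgm x y 0 (axis m 1) (axis l 1) (axis k 1)"
proof (rule partial_eq)
  have "((\<lambda>y. gm x y (axis l 1) (axis k 1)) has_derivative (\<lambda>b. dgm x y 0 b (axis l 1) (axis k 1))) (at y)"
    using has_derivative_gm[OF has_derivative_const has_derivative_ident has_derivative_const x y]
    by (simp add: gm_def ell_lin dell_def d\<eta>_fibre dcc_def dF_def x DW_lin Dh_lin)
  then show "((\<lambda>y. fund F x y $ l $ k) has_derivative (\<lambda>b. dgm x y 0 b (axis l 1) (axis k 1))) (at y)"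
    by (rule has_derivative_transform_within_open[OF _ open_nonzero]) (use y in \<open>simp_all add: fund_component x\<close>)
qed

lemma hor_deriv_fund: "hor_deriv F j (\<lambda>x y. fund F x y $ l $ k) x y = hor x y (axis j 1) (axis l 1) (axis k 1)"
proof -
  have lin: "linear (\<lambda>b. dgm x y 0 b (axis l 1) (axis k 1))"
    using dgm_lin(1)[OF x, of y 0 0] dgm_lin(2)[OF x, of y _ 0] by (auto intro!: linearI)
  have "hor x y (axis j 1) (axis l 1) (axis k 1) = dgm x y (axis j 1) 0 (axis l 1) (axis k 1)
      - dgm x y 0 (dGv x y (axis j 1)) (axis l 1) (axis k 1)"
    using dgm_lin(1)[OF x, of y "axis j 1" 0 0 "- dGv x y (axis j 1)" "axis l 1" "axis k 1"]
      linear_neg[OF lin] by (simp add: hor_def)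
  then show ?thesis
    unfolding hor_deriv_def partial_fund_x partial_fund_y nonlin_conn_eq[OF x y]
    using linear_expand[OF lin, of "dGv x y (axis j 1)"] by simp
qed

lemma hor_linear: "linear (\<lambda>a. hor x y a Y Z)" "linear (\<lambda>Y. hor x y a Y Z)" "linear (hor x y a Y)"
proof -
  show "linear (\<lambda>a. hor x y a Y Z)"
    using dGv_linear[OF x y] dgm_lin(1)[OF x, of y _ _ "- dGv x y _" "- dGv x y _"]
      dgm_lin(2)[OF x, of y _ _ "- dGv x y _"]
    by (auto intro!: linearI simp: hor_def linear_add linear_scale scaleR_minus_right[symmetric]
        simp del: scaleR_minus_right)
  show "linear (\<lambda>Y. hor x y a Y Z)" for Z by (auto intro!: linearI simp: hor_def dgm_lin[OF x])
  moreover have "(\<lambda>Z. hor x y a Z Y) = hor x y a Y"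
    unfolding hor_def by (rule ext) (rule dgm_comm[OF x])
  ultimately show "linear (hor x y a Y)" by metis
qed

lemma chern_lowered:
  fixes X V :: "real^'n"
  defines "C \<equiv> (\<chi> i. \<Sum>j\<in>UNIV. \<Sum>k\<in>UNIV. chern F x y i j k * X $ j * V $ k)"
  shows "2 * gm x y C Z = hor x y X Z V + hor x y V X Z - hor x y Z X V"
proof -
  have "2 * bf (fund F x y) Z C = hor x y X Z V + hor x y V X Z - hor x y Z X V"
    unfolding C_def chern_def hor_deriv_fund
    by (rule christoffel_lowered[OF fund_invertible[OF x y] hor_linear])
  then show ?thesis by (simp add: bf_fund[OF x y] gm_comm[OF x, of y C])
qed

text \<open>Contracting with the reference vector, the Cartan tensor drops out.\<close>

lemma dgm_y_x: "dgm x y a 0 y Z = phi x y a * ell x y Z + F x y * dell x y a 0 Z"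
proof -
  have gm0: "gm x y 0 Z = 0" for Z using gm_linear(1)[OF x] linear_0 by blast
  have 1: "((\<lambda>x. gm x y y Z) has_derivative (\<lambda>a. dgm x y a 0 y Z)) (at x)"
    using has_derivative_gm[OF has_derivative_ident has_derivative_const has_derivative_const x y]
    by (simp add: gm0)
  have "((\<lambda>x. F x y * ell x y Z) has_derivative
      (\<lambda>a. phi x y a * ell x y Z + F x y * dell x y a 0 Z)) (at x)"
    by (rule has_derivative_eq_rhs[OF has_derivative_mult[OF
          has_derivative_F[OF has_derivative_ident has_derivative_const x y]
          has_derivative_ell[OF has_derivative_ident has_derivative_const x y has_derivative_const]]])
       (simp add: fun_eq_iff)
  then have "((\<lambda>x. gm x y y Z) has_derivative
      (\<lambda>a. phi x y a * ell x y Z + F x y * dell x y a 0 Z)) (at x)"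
    by (rule has_derivative_transform_within_open[OF _ open_U x])
       (use y in \<open>simp add: gm_comm[of _ y y Z] gm_y\<close>)
  from has_derivative_unique[OF 1 this] show ?thesis by (rule fun_cong)
qed

text \<open>Differentiate g(y, Z) = F ell(Z) in the fibre: the motion of the inserted
  \<open>y\<close> alone already gives \<open>gm x y b Z\<close>, which is the whole right-hand
  side.\<close>

lemma dgm_y_y: "dgm x y 0 b y Z = 0"
proof -
  have 1: "((\<lambda>y. gm x y y Z) has_derivative (\<lambda>b. dgm x y 0 b y Z + gm x y b Z)) (at y)"
    using has_derivative_gm[OF has_derivative_const has_derivative_ident has_derivative_ident x y]
    by simp
  have "((\<lambda>y. F x y * ell x y Z) has_derivative (\<lambda>b. gm x y b Z)) (at y)"
    by (rule has_derivative_eq_rhs[OF has_derivative_mult[OF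
          has_derivative_F[OF has_derivative_const has_derivative_ident x y]
          has_derivative_ell[OF has_derivative_const has_derivative_ident x y has_derivative_const]]])
       (simp add: fun_eq_iff gm_def x)
  then have "((\<lambda>y. gm x y y Z) has_derivative (\<lambda>b. gm x y b Z)) (at y)"
    by (rule has_derivative_transform_within_open[OF _ open_nonzero])
       (use y in \<open>simp_all add: gm_comm[OF x, of _ _ Z] gm_y[OF x]\<close>)
  from fun_cong[OF has_derivative_unique[OF 1 this], of b] show ?thesis by simp
qed

lemma hor_y: "hor x y a y Z = phi x y a * ell x y Z + F x y * dell x y a 0 Z"
  using dgm_lin(1)[OF x, of y a 0 0 "- dGv x y a" y Z] by (simp add: hor_def dgm_y_x dgm_y_y)

text \<open>Along (y, -2G) the value \<open>F\<close> is constant, \<open>ell\<close> changes by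
  \<open>phi\<close>, and \<open>cc\<close> by R(\<eta>, \<eta>) cc / F, so no spray is left. The
  factor 1/cc of g on tangent vectors is the source of the term with \<open>R\<close>.\<close>

lemma hor_geodesic:
  assumes X: "ell x y X = 0" and Z: "ell x y Z = 0"
  shows "cc x y * hor x y y X Z = - R x (\<eta> x y) (\<eta> x y) * bf (h x) X Z
    + F x y * (bf (Dh x y) X Z - phi x y X * bf (h x) (W x) Z - phi x y Z * bf (h x) (W x) X)"
proof -
  have c: "cc x y \<noteq> 0" and F: "F x y \<noteq> 0" using cc_pos[OF x y] F_pos[OF x y] by simp_all
  have g: "- dGv x y y = - 2 *\<^sub>R Gv x y" by (simp add: dGv_homogeneous[OF x y])
  show ?thesis
    unfolding hor_def g dgm_def dgE_def gE_def X Z dell_geodesic[OF x y] dF_geodesic[OF x y] dcc_geodesic[OF x y]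
    using c F by (simp add: field_simps)
qed

end

end

section \<open>Second fundamental forms\<close>

text \<open>Two candidates differ by a tangent vector that is g-orthogonal to all tangent vectors,
  so definiteness on the tangent space makes \<open>THE\<close> well-defined.\<close>

lemma tangential_eq:
  fixes g :: "real^'n^'n" and L :: "real^'m \<Rightarrow> real^'n"
  assumes L: "linear L" and pos: "\<And>v. bf g (L v) (L v) = 0 \<Longrightarrow> v = 0"
    and v: "\<And>u. bf g (Z - L v) (L u) = 0"
  shows "tangential g L Z = v"
  unfolding tangential_def bf_def[symmetric]
proof (rule the_equality)
  fix w assume w: "\<forall>u. bf g (Z - L w) (L u) = 0"
  have "bf g (L (w - v)) (L (w - v)) = bf g (Z - L v) (L (w - v)) - bf g (Z - L w) (L (w - v))"
    by (simp add: linear_diff[OF L])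
  then have "bf g (L (w - v)) (L (w - v)) = 0" using w v by simp
  then show "w = v" using pos[of "w - v"] by simp
qed (use v in blast)

text \<open>The Gram map of a tangent basis is an injective linear endomorphism, hence onto, so the
  normal equations are solvable.\<close>

lemma tangential_exists:
  fixes g :: "real^'n^'n" and L :: "real^'m \<Rightarrow> real^'n"
  assumes L: "linear L" and pos: "\<And>v. bf g (L v) (L v) = 0 \<Longrightarrow> v = 0"
  obtains v where "\<And>u. bf g (Z - L v) (L u) = 0"
proof -
  define G where "G v = (\<chi> i. bf g (L v) (L (axis i 1)))" for v
  have lin: "linear G"
    by (rule linearI) (simp_all add: G_def vec_eq_iff linear_add[OF L] linear_scale[OF L])
  have ex: "bf g a (L u) = (\<Sum>i\<in>UNIV. u $ i * bf g a (L (axis i 1)))" for a u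
    by (rule linear_expand) (auto intro!: linearI simp: linear_add[OF L] linear_scale[OF L])
  have "inj G"
    unfolding linear_injective_0[OF lin]
  proof (intro allI impI)
    fix v assume "G v = 0"
    then have "bf g (L v) (L (axis i 1)) = 0" for i by (simp add: G_def vec_eq_iff)
    then have "bf g (L v) (L v) = 0" using ex[of "L v" v] by simp
    then show "v = 0" by (rule pos)
  qed
  then obtain v where v: "G v = (\<chi> i. bf g Z (L (axis i 1)))"
    using linear_injective_imp_surjective[OF lin] by (metis surjD)
  have "bf g (Z - L v) (L u) = 0" for u
    using ex[of "Z - L v" u] v by (simp add: G_def vec_eq_iff)
  then show ?thesis by (rule that)
qed

section \<open>Unit normals for F and for h, and derivatives of normal sections\<close>

context randers_data
begin

lemma unit_normal_nonzero: "f t \<in> U \<Longrightarrow> unit_normal F f t n \<Longrightarrow> n \<noteq> 0"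
  by (auto simp: unit_normal_def F_zero)

lemma unit_normal_ell:
  assumes x: "f t \<in> U" and n: "unit_normal F f t n"
  shows "F (f t) n = 1" "ell (f t) n (frechet_derivative f (at t) v) = 0"
    "\<eta> (f t) n = n - W (f t)"
proof -
  show F1: "F (f t) n = 1" using n by (simp add: unit_normal_def)
  then show "\<eta> (f t) n = n - W (f t)" by (simp add: \<eta>_def)
  have n0: "n \<noteq> 0" by (rule unit_normal_nonzero[OF x n])
  have "gm (f t) n n (frechet_derivative f (at t) v) = 0"
    using n by (simp add: unit_normal_def bf_def[symmetric] bf_fund[OF x n0])
  then show "ell (f t) n (frechet_derivative f (at t) v) = 0"
    using gm_y[OF x n0] by (simp add: gm_comm[OF x, of n n] F1)
qed

text \<open>\<open>ell\<close> is a positive multiple of h(\<eta>, .), and \<open>F = 1\<close>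
  makes \<eta> equal to n - W, so the orthogonality conditions agree. For the converse, uniqueness
  of the navigation root recovers \<open>F = 1\<close>.\<close>

lemma unit_normal_iff:
  assumes x: "f t \<in> U"
  shows "unit_normal F f t n \<longleftrightarrow> riem_unit_normal h f t (n - W (f t))"
proof
  assume n: "unit_normal F f t n"
  note n' = unit_normal_ell[OF x n]
  have c: "cc (f t) n > 0" by (rule cc_pos[OF x unit_normal_nonzero[OF x n]])
  show "riem_unit_normal h f t (n - W (f t))"
    unfolding riem_unit_normal_def bf_def[symmetric] n'(3)[symmetric]
    using navigation[OF x, of n] n'(1,2) c by (simp add: ell_def)
next
  assume r: "riem_unit_normal h f t (n - W (f t))"
  then have 1: "bf (h (f t)) (n - W (f t)) (n - W (f t)) = 1"
    and 0: "bf (h (f t)) (n - W (f t)) (frechet_derivative f (at t) v) = 0" for v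
    by (simp_all only: riem_unit_normal_def bf_def)
  \<comment> \<open>For \<open>n = 0\<close> the vector \<open>W\<close> would have h-length
    1.\<close>
  have n0: "n \<noteq> 0" using 1 W_small[OF x] by auto
  have F1: "F (f t) n = 1" using F_unique[OF x, of 1 n] n0 1 by simp
  then have "ell (f t) n (frechet_derivative f (at t) v) = 0" for v
    using 0 by (simp add: ell_def \<eta>_def)
  then have "gm (f t) n n (frechet_derivative f (at t) v) = 0" for v
    using gm_y[OF x n0] by (simp add: gm_comm[OF x, of n n])
  then show "unit_normal F f t n"
    unfolding unit_normal_def bf_def[symmetric] by (simp add: F1 bf_fund[OF x n0])
qed

text \<open>This is - h(e, B + \<Gamma>(X, Z)) with the Christoffel symbols of \<open>h\<close>
  lowered by Koszul's formula: the second fundamental form up to sign, when \<open>B\<close> is the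
  second derivative of the immersion.\<close>

definition "second_form x e X Z B = (bf (Dh x e) X Z - bf (Dh x X) e Z - bf (Dh x Z) e X) / 2 - bf (h x) e B"

context
  fixes f :: "real^'m::finite \<Rightarrow> real^'n" and S s v f2
  assumes S: "open S" "s \<in> S" and fU: "\<And>t. t \<in> S \<Longrightarrow> f t \<in> U"
    and f': "f differentiable (at s)"
    and f2: "((\<lambda>t. frechet_derivative f (at t) v) has_derivative f2) (at s)"
begin

text \<open>Differentiating h(\<nu>, df v) = 0 removes the derivative of \<open>\<nu>\<close>. The
  result sees only the value \<open>\<nu> s\<close>, so it does not matter which section
  \<open>SOME\<close> selects.\<close>

lemma riem_second_form:
  assumes n: "\<And>t. t \<in> S \<Longrightarrow> riem_unit_normal h f t (\<nu> t)" and \<nu>: "\<nu> differentiable (at s)"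
  shows "bf (h (f s)) (cov_along (christoffel h (f s)) f \<nu> s u) (frechet_derivative f (at s) v)
    = second_form (f s) (\<nu> s) (frechet_derivative f (at s) u) (frechet_derivative f (at s) v) (f2 u)"
proof -
  let ?f' = "frechet_derivative f (at s)" and ?n' = "frechet_derivative \<nu> (at s)"
  have x: "f s \<in> U" using fU S by blast
  have f1: "(f has_derivative ?f') (at s)" and n1: "(\<nu> has_derivative ?n') (at s)"
    using f' \<nu> frechet_derivative_works by blast+
  let ?x = "f s" and ?X = "?f' u" and ?Z = "?f' v"
  have hf: "((\<lambda>t. h (f t)) has_derivative (\<lambda>d. Dh ?x (?f' d))) (at s)"
    by (rule has_derivative_compose[OF f1 h_deriv[OF x]])
  have "((\<lambda>t. bf (h (f t)) (\<nu> t) (frechet_derivative f (at t) v)) has_derivative (\<lambda>d. 0)) (at s)"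
    by (rule has_derivative_transform_within_open[OF has_derivative_const S])
       (use n in \<open>simp add: riem_unit_normal_def bf_def\<close>)
  from fun_cong[OF has_derivative_unique[OF has_derivative_bf[OF hf n1 f2] this], of u]
  have 1: "bf (h ?x) (?n' u) ?Z = - bf (Dh ?x ?X) (\<nu> s) ?Z - bf (h ?x) (\<nu> s) (f2 u)"
    by simp
  define C where "C = (\<chi> i. \<Sum>j\<in>UNIV. \<Sum>k\<in>UNIV. christoffel h ?x i j k * ?X $ j * \<nu> s $ k)"
  have part: "partial j (\<lambda>x. h x $ l $ k) ?x = bf (Dh ?x (axis j 1)) (axis l 1) (axis k 1)" for j l k
    unfolding bf_axis
    by (rule partial_eq) (rule has_derivative_component[OF has_derivative_component[OF h_deriv[OF x]]])
  have "2 * bf (h ?x) ?Z C = bf (Dh ?x ?X) ?Z (\<nu> s) + bf (Dh ?x (\<nu> s)) ?X ?Z - bf (Dh ?x ?Z) ?X (\<nu> s)"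
    unfolding C_def christoffel_def part
    by (rule christoffel_lowered[OF h_invertible[OF x]]) (auto intro!: linearI simp: Dh_lin[OF x])
  then have "2 * bf (h ?x) C ?Z = bf (Dh ?x ?X) (\<nu> s) ?Z + bf (Dh ?x (\<nu> s)) ?X ?Z - bf (Dh ?x ?Z) (\<nu> s) ?X"
    by (simp only: h_comm[OF x, of C] Dh_comm[OF x, of ?X "\<nu> s" ?Z] Dh_comm[OF x, of ?Z "\<nu> s" ?X])
  moreover have "cov_along (christoffel h ?x) f \<nu> s u = ?n' u + C"
    by (simp add: cov_along_def C_def)
  ultimately show ?thesis using 1 by (simp add: second_form_def)
qed

text \<open>The Riemannian argument with \<open>ell\<close> as conormal: differentiating ell(df v) =
  0 removes the derivative of \<open>\<nu>\<close>, and the Chern term adds base derivatives of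
  \<open>ell\<close> and the horizontal derivative of g along \<open>y\<close>. The factor
  \<open>cc\<close> compensates g = h / cc on tangent vectors.\<close>

lemma randers_second_form:
  fixes u
  assumes n: "\<And>t. t \<in> S \<Longrightarrow> unit_normal F f t (\<nu> t)" and \<nu>: "\<nu> differentiable (at s)"
  defines "x \<equiv> f s" and "X \<equiv> frechet_derivative f (at s) u" and "Z \<equiv> frechet_derivative f (at s) v"
    and "e \<equiv> \<nu> s - W (f s)"
  shows "cc x (\<nu> s) * gm x (\<nu> s) (cov_along (chern F x (\<nu> s)) f \<nu> s u) Z
    = second_form x e X Z (f2 u) + R x X Z - R x e e / 2 * bf (h x) X Z"
proof -
  let ?f' = "frechet_derivative f (at s)" and ?n' = "frechet_derivative \<nu> (at s)" and ?y = "\<nu> s"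
  have x: "x \<in> U" using fU S by (simp add: x_def)
  have y: "?y \<noteq> 0" using unit_normal_nonzero[OF fU n] S by blast
  have f1: "(f has_derivative ?f') (at s)" and n1: "(\<nu> has_derivative ?n') (at s)"
    using f' \<nu> frechet_derivative_works by blast+
  note un = unit_normal_ell[OF fU n, OF S(2) S(2), folded x_def]
  have F1: "F x ?y = 1" and lX: "ell x ?y X = 0" and lZ: "ell x ?y Z = 0" and e: "\<eta> x ?y = e"
    using un by (simp_all add: X_def Z_def e_def x_def)
  have c: "cc x ?y \<noteq> 0" using cc_pos[OF x y] by simp
  have x': "f s \<in> U" using x by (simp add: x_def)
  have "((\<lambda>t. ell (f t) (\<nu> t) (frechet_derivative f (at t) v)) has_derivative (\<lambda>d. 0)) (at s)"
    by (rule has_derivative_transform_within_open[OF has_derivative_const S])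
       (simp add: unit_normal_ell(2)[OF fU n])
  from fun_cong[OF has_derivative_unique[OF has_derivative_ell[OF f1 n1 x' y f2] this], of u]
  have "dell x ?y X (?n' u) Z = - ell x ?y (f2 u)"
    by (simp add: x_def X_def Z_def)
  then have 1: "gm x ?y (?n' u) Z = - dell x ?y X 0 Z - ell x ?y (f2 u)"
    using dell_split[OF x, of ?y X "?n' u" Z] by (simp add: gm_def lZ F1)
  define C where "C = (\<chi> i. \<Sum>j\<in>UNIV. \<Sum>k\<in>UNIV. chern F x ?y i j k * X $ j * ?y $ k)"
  have hc: "hor x ?y a b ?y = hor x ?y a ?y b" for a b
    unfolding hor_def by (rule dgm_comm[OF x])
  have "2 * gm x ?y C Z = dell x ?y X 0 Z + hor x ?y ?y X Z - dell x ?y Z 0 X"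
    unfolding C_def chern_lowered[OF x y] hc hor_y[OF x y] by (simp add: F1 lX lZ)
  moreover have "cov_along (chern F x ?y) f \<nu> s u = ?n' u + C"
    by (simp add: cov_along_def C_def X_def)
  ultimately have main: "2 * gm x ?y (cov_along (chern F x ?y) f \<nu> s u) Z
      = - dell x ?y X 0 Z - dell x ?y Z 0 X + hor x ?y ?y X Z - 2 * ell x ?y (f2 u)"
    using 1 by (simp add: linear_add[OF gm_linear(1)[OF x]])
  have "2 * (cc x ?y * gm x ?y (cov_along (chern F x ?y) f \<nu> s u) Z)
      = - (cc x ?y * dell x ?y X 0 Z) - cc x ?y * dell x ?y Z 0 X + cc x ?y * hor x ?y ?y X Z
        - 2 * (cc x ?y * ell x ?y (f2 u))"
    using arg_cong[OF main, of "\<lambda>r. cc x ?y * r"] by (simp add: algebra_simps)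
  moreover have "cc x ?y * dell x ?y a 0 b = bf (Dh x a) e b - phi x ?y a * bf (h x) (W x) b
      - bf (h x) (DW x a) b" if "ell x ?y b = 0" for a b
    using c that by (simp add: dell_def d\<eta>_def dF_def F1 e)
  \<comment> \<open>The terms with \<open>phi\<close> coming from \<open>dell\<close> cancel those
    of \<open>hor_geodesic\<close>.\<close>
  ultimately have "2 * (cc x ?y * gm x ?y (cov_along (chern F x ?y) f \<nu> s u) Z)
      = - bf (Dh x X) e Z + bf (h x) (DW x X) Z - bf (Dh x Z) e X + bf (h x) (DW x Z) X
        - R x e e * bf (h x) X Z + bf (Dh x ?y) X Z - 2 * bf (h x) e (f2 u)"
    unfolding hor_geodesic[OF x y lX lZ] cc_ell[OF x y] e F1 using lX lZ by simp
  moreover have "bf (Dh x ?y) X Z = bf (Dh x e) X Z + bf (Dh x (W x)) X Z"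
    using Dh_lin(1)[OF x, of e "W x"] by (simp add: e_def x_def flip: bf_add)
  moreover have "2 * R x X Z = bf (Dh x (W x)) X Z + bf (h x) (DW x Z) X + bf (h x) (DW x X) Z"
    by (simp add: R_def h_comm[OF x, of X "DW x Z"])
  moreover have "R x e e / 2 * bf (h x) X Z = (R x e e * bf (h x) X Z) / 2" by simp
  ultimately show ?thesis unfolding second_form_def by (simp only: diff_divide_distrib)
qed

end

end

section \<open>Volumes of ellipsoids\<close>

text \<open>The library's \<open>measure_linear_image\<close> needs a well-ordered index type.\<close>

lemma measure_shear_cbox:
  fixes a b :: "real^'n::finite"
  assumes "m \<noteq> n"
  shows "measure lebesgue ((\<lambda>x. \<chi> i. if i = m then x $ m + x $ n else x $ i) ` cbox a b)
    = measure lebesgue (cbox a b)"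
proof (cases "cbox a b = {}")
  case False
  let ?h = "\<lambda>x::real^'n. \<chi> i. if i = m then x $ m + x $ n else x $ i"
  \<comment> \<open>Moves the lower bound of coordinate \<open>n\<close> to 0, since the shear
    formula wants it nonnegative; by linearity the shear turns this shift into another
    translation.\<close>
  define v :: "real^'n" where "v = axis n (- a $ n)"
  have "?h ` (+) v ` cbox a b = (+) (?h v) ` ?h ` cbox a b"
    by (auto simp: image_image vec_eq_iff intro!: image_cong)
  moreover have "measure lebesgue (?h ` (+) v ` cbox a b) = measure lebesgue ((+) v ` cbox a b)"
    unfolding cbox_translation[symmetric]
    by (rule measure_shear_interval[OF assms])
      (use False in \<open>simp_all add: v_def cbox_translation\<close>)
  ultimately show ?thesis by (simp add: measure_translation)
qed auto

text \<open>Both sides are multiplicative in \<open>A\<close>, so elementary matrices suffice: a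
  zero row makes the image negligible, diagonal matrices are stretches, and for transpositions and
  shears boxes decide.\<close>

lemma measure_matrix_image:
  fixes A :: "real^'n::finite^'n" and S :: "(real^'n) set"
  assumes "S \<in> lmeasurable"
  shows "(*v) A ` S \<in> lmeasurable \<and> measure lebesgue ((*v) A ` S) = \<bar>det A\<bar> * measure lebesgue S"
  using assms
proof (induction A arbitrary: S rule: induct_matrix_elementary_alt)
  case (1 A B S)
  have "(*v) (A ** B) ` S = (*v) A ` (*v) B ` S"
    by (simp add: image_image matrix_vector_mul_assoc)
  then show ?case using 1(1)[OF 1(2)[OF 1(3), THEN conjunct1]] 1(2)[OF 1(3)] by (simp add: det_mul abs_mult)
next
  case (2 A i S)
  have d: "det A = 0" by (rule det_zero_row(2)[OF 2(1)])
  then have "\<not> inj ((*v) A)"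
    using det_nz_iff_inj[OF matrix_vector_mul_linear, of A] by simp
  then have "negligible ((*v) A ` S)"
    by (rule negligible_linear_singular_image[OF matrix_vector_mul_linear])
  then show ?case using d by (simp add: negligible_iff_measure)
next
  case (3 A S)
  have "(\<Sum>j\<in>UNIV. A $ i $ j * x $ j) = A $ i $ i * x $ i" for x :: "real^'n" and i
    by (subst sum.remove[of _ i]) (auto simp: 3(1) intro!: sum.neutral)
  then have "(*v) A = (\<lambda>x. \<chi> k. A $ k $ k * x $ k)"
    by (simp add: fun_eq_iff vec_eq_iff matrix_vector_mult_def)
  then show ?case
    using measurable_stretch[OF 3(2), of "\<lambda>k. A $ k $ k"] measure_stretch[OF 3(2), of "\<lambda>k. A $ k $ k"]
      det_diagonal[OF 3(1)] by simp
next
  case (4 m n S)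
  let ?A = "\<chi> i j. mat 1 $ i $ Transposition.transpose m n j :: real^'n^'n"
  let ?t = "Transposition.transpose m n"
  have A: "?A *v x = (\<chi> i. x $ ?t i)" for x
  proof -
    have "i = ?t j \<longleftrightarrow> j = ?t i" for i j by (metis transpose_involutory)
    then have "(\<Sum>j\<in>UNIV. mat 1 $ i $ ?t j * x $ j) = x $ ?t i" for i
      by (simp add: mat_def if_distrib[of "\<lambda>c. c * _"] cong: if_cong)
    then show ?thesis by (simp add: matrix_vector_mult_def vec_eq_iff)
  qed
  have det: "\<bar>det ?A\<bar> = 1"
    by (simp add: det_permute_columns[OF permutes_swap_id] sign_swap_id abs_mult)
  have "measure lebesgue ((*v) ?A ` cbox a b) = 1 * measure lebesgue (cbox a b)" for a b
  proof -
    have "(*v) ?A ` cbox a b = cbox (?A *v a) (?A *v b)"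
    proof (intro equalityI subsetI)
      fix z assume "z \<in> cbox (?A *v a) (?A *v b)"
      then have z1: "?A *v z \<in> cbox a b" unfolding A mem_box_cart by simp (metis transpose_involutory)
      have z2: "z = ?A *v (?A *v z)" by (simp add: A vec_eq_iff)
      show "z \<in> (*v) ?A ` cbox a b" by (subst z2) (rule imageI[OF z1])
    qed (auto simp: A mem_box_cart)
    moreover have "cbox (?A *v a) (?A *v b) = {} \<longleftrightarrow> cbox a b = {}"
      using calculation by blast
    moreover have "(\<Prod>i\<in>UNIV. (b - a) $ ?t i) = (\<Prod>i\<in>UNIV. (b - a) $ i)"
      using prod.permute[OF permutes_swap_id[of m UNIV n], of "\<lambda>i. (b - a) $ i"] by (simp add: o_def)
    ultimately show ?thesis
      by (cases "cbox a b = {}") (simp_all add: content_cbox_cart A)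
  qed
  from measure_linear_sufficient[OF matrix_vector_mul_linear 4(2) this]
  show ?case unfolding det by simp
next
  case (5 m n S)
  let ?A = "\<chi> i j. of_bool (i = m \<and> j = n \<or> i = j) :: real^'n^'n"
  have A: "?A *v x = (\<chi> i. if i = m then x $ m + x $ n else x $ i)" for x
    using 5(1)
    by (auto simp: matrix_vector_mult_def vec_eq_iff of_bool_def if_distrib[of "\<lambda>c. c * _"]
        sum.remove[of UNIV n] sum.delta' cong: if_cong)
  have "?A = (\<chi> k. if k = m then row m (mat 1) + 1 *s row n (mat 1) else row k (mat 1))"
    using 5(1) by (auto simp: vec_eq_iff row_def mat_def)
  then have det: "det ?A = 1"
    using det_row_operation[OF 5(1), of "mat 1 :: real^'n^'n" 1] by (simp only: det_I)
  have "measure lebesgue ((*v) ?A ` cbox a b) = 1 * measure lebesgue (cbox a b)" for a b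
    unfolding A using measure_shear_cbox[OF 5(1)] by simp
  from measure_linear_sufficient[OF matrix_vector_mul_linear 5(2) this]
  show ?case unfolding det by simp
qed

text \<open>The columns of \<open>B\<close> form a basis orthonormal for \<open>A\<close>, built one
  vector at a time; the determinant identity is that of
  \<open>transpose B ** A ** B = mat 1\<close>.\<close>

lemma orthonormal_matrix_exists:
  fixes A :: "real^'n::finite^'n"
  assumes sym: "transpose A = A" and pos: "\<And>v. v \<noteq> 0 \<Longrightarrow> bf A v v > 0"
  obtains B where "\<And>u v. bf A (B *v u) (B *v v) = u \<bullet> v" "(det B)\<^sup>2 * det A = 1"
proof -
  have "\<exists>e. \<forall>i\<in>S. \<forall>j\<in>S. bf A (e i) (e j) = of_bool (i = j)" for S :: "'n set"
    using finite[of S]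
  proof (induction S rule: finite_induct)
    case (insert a S)
    then obtain e :: "'n \<Rightarrow> real^'n" where e: "\<And>i j. i \<in> S \<Longrightarrow> j \<in> S \<Longrightarrow> bf A (e i) (e j) = of_bool (i = j)"
      by blast
    define L where "L v = (\<chi> i. if i \<in> S then bf A (e i) v else 0)" for v
    have L: "linear L" by (rule linearI) (simp_all add: L_def vec_eq_iff)
    \<comment> \<open>Coordinate \<open>a\<close> of \<open>L\<close> is constantly 0, so
      \<open>L\<close> is not onto and hence not injective; its kernel supplies the next
      vector.\<close>
    have "axis a 1 \<notin> range L"
    proof
      assume "axis a 1 \<in> range L"
      then obtain v where "axis a 1 = L v" by auto
      then have "axis a 1 $ a = L v $ a" by simp
      then show False using insert(2) by (simp add: L_def)
    qed
    then have "\<not> inj L" using linear_injective_imp_surjective[OF L] by blast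
    then obtain v where v: "L v = 0" "v \<noteq> 0" unfolding linear_injective_0[OF L] by blast
    have ev: "bf A (e i) v = 0" if "i \<in> S" for i
      using that arg_cong[OF v(1), of "\<lambda>w. w $ i"] by (simp add: L_def)
    have ve: "bf A v (e i) = 0" if "i \<in> S" for i
      using ev[OF that] bf_commute[OF sym, of v "e i"] by simp
    define w where "w = (1 / sqrt (bf A v v)) *\<^sub>R v"
    have w: "bf A w w = 1" using pos[OF v(2)] by (simp add: w_def)
    have "\<forall>i\<in>insert a S. \<forall>j\<in>insert a S. bf A ((e(a := w)) i) ((e(a := w)) j) = of_bool (i = j)"
      using insert(2) e w by (auto simp: w_def ev ve simp del: bf_scaleR(1))
    then show ?case by blast
  qed auto
  from this[of UNIV] obtain e :: "'n \<Rightarrow> real^'n" where e: "\<And>i j. bf A (e i) (e j) = of_bool (i = j)" by auto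
  define B :: "real^'n^'n" where "B = (\<chi> i j. e j $ i)"
  have B: "B *v u = (\<Sum>j\<in>UNIV. u $ j *\<^sub>R e j)" for u
    by (simp add: B_def matrix_vector_mult_def vec_eq_iff algebra_simps)
  have 1: "bf A (B *v u) (B *v v) = u \<bullet> v" for u v
    by (simp add: B bf_sum e inner_vec_def of_bool_def if_distrib[of "\<lambda>c. _ * c"] ac_simps cong: if_cong)
  have "bf (transpose B ** A ** B) u v = bf (mat 1) u v" for u v
  proof -
    have "u \<bullet> ((A *v (B *v v)) v* B) = (B *v u) \<bullet> (A *v (B *v v))"
      by (metis dot_lmul_matrix inner_commute)
    then show ?thesis
      using 1[of u v] by (simp only: bf_def matrix_vector_mul_assoc[symmetric] transpose_matrix_vector
          matrix_vector_mul_lid)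
  qed
  then have "(transpose B ** A ** B) $ i $ j = mat 1 $ i $ j" for i j
    by (metis bf_axis)
  then have "transpose B ** A ** B = mat 1" by (simp add: vec_eq_iff)
  then have "det B * det A * det B = 1" by (metis det_I det_mul det_transpose)
  then have 2: "(det B)\<^sup>2 * det A = 1" by (simp add: power2_eq_square algebra_simps)
  show ?thesis by (rule that[OF 1 2])
qed

text \<open>The ellipsoid is a translate of the image of the unit ball under an
  \<open>A\<close>-orthonormal frame.\<close>

lemma measure_ellipsoid:
  fixes A :: "real^'n::finite^'n"
  assumes sym: "transpose A = A" and pos: "\<And>v. v \<noteq> 0 \<Longrightarrow> bf A v v > 0"
  shows "det A > 0"
    and "measure lebesgue {v. bf A (v - w) (v - w) < 1} = measure lebesgue (ball (0::real^'n) 1) / sqrt (det A)"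
proof -
  obtain B where B: "\<And>u v. bf A (B *v u) (B *v v) = u \<bullet> v" and d: "(det B)\<^sup>2 * det A = 1"
    using orthonormal_matrix_exists[OF assms] by blast
  show dp: "det A > 0"
  proof (rule ccontr)
    assume "\<not> det A > 0"
    then have "(det B)\<^sup>2 * det A \<le> 0" by (simp add: mult_nonneg_nonpos)
    then show False using d by simp
  qed
  have "det B \<noteq> 0" using d by auto
  then have inv: "invertible B" by (simp add: invertible_det_nz)
  have "(det B)\<^sup>2 = 1 / det A" using d dp by (simp add: field_simps)
  then have db: "\<bar>det B\<bar> = 1 / sqrt (det A)" by (metis real_sqrt_abs real_sqrt_divide real_sqrt_one)
  have "{v. bf A (v - w) (v - w) < 1} = (+) w ` (*v) B ` ball 0 1"
  proof (intro equalityI subsetI)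
    fix v assume v: "v \<in> {v. bf A (v - w) (v - w) < 1}"
    define u where "u = matrix_inv B *v (v - w)"
    have vu: "v = w + B *v u" by (simp add: u_def matrix_inv_apply[OF inv])
    then have "u \<bullet> u < 1" using v by (simp add: B del: bf_diff bf_add)
    then have "u \<in> ball 0 1" by (simp add: norm_eq_sqrt_inner)
    then show "v \<in> (+) w ` (*v) B ` ball 0 1" using vu by blast
  next
    fix v assume "v \<in> (+) w ` (*v) B ` ball 0 1"
    then obtain u where u: "v = w + B *v u" "norm u < 1" by auto
    then show "v \<in> {v. bf A (v - w) (v - w) < 1}"
      by (simp add: B norm_eq_sqrt_inner del: bf_diff bf_add)
  qed
  then show "measure lebesgue {v. bf A (v - w) (v - w) < 1} = measure lebesgue (ball (0::real^'n) 1) / sqrt (det A)"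
    using measure_matrix_image[OF lmeasurable_ball, of B 0 1] by (simp add: measure_translation db)
qed

section \<open>Jacobi's formula\<close>

text \<open>In the Leibniz formula a permutation other than the identity moves at least two indices,
  so at the identity matrix its product vanishes even with one factor left out.\<close>

lemma has_derivative_det_at_mat1:
  fixes M :: "'a::real_normed_vector \<Rightarrow> real^'n::finite^'n"
  assumes M: "(M has_derivative M') (at x)" and 1: "M x = mat 1"
  shows "((\<lambda>x. det (M x)) has_derivative (\<lambda>a. \<Sum>i\<in>UNIV. M' a $ i $ i)) (at x)"
proof -
  have c: "((\<lambda>x. M x $ i $ j) has_derivative (\<lambda>a. M' a $ i $ j)) (at x)" for i j
    by (rule has_derivative_component[OF has_derivative_component[OF M]])
  have z: "(\<Prod>j\<in>UNIV - {i}. M x $ j $ p j) = of_bool (p = id)" if p: "p permutes UNIV" for p i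
  proof (cases "p = id")
    case False
    then obtain a where a: "p a \<noteq> a" by (auto simp: fun_eq_iff)
    \<comment> \<open>If the moved index is the omitted \<open>i\<close> itself, its image
      \<open>p i\<close> is another moved index, by injectivity.\<close>
    define j where "j = (if a = i then p i else a)"
    have "p j \<noteq> j" "j \<noteq> i" using a permutes_inj[OF p] by (auto simp: j_def dest: injD split: if_splits)
    then show ?thesis using False by (auto simp: 1 mat_def intro!: prod_zero bexI[of _ j])
  qed (simp add: 1 mat_def)
  have "((\<lambda>x. \<Sum>p | p permutes (UNIV::'n set). of_int (sign p) * (\<Prod>i\<in>UNIV. M x $ i $ p i)) has_derivative
      (\<lambda>a. \<Sum>p | p permutes (UNIV::'n set). of_int (sign p) * (\<Sum>i\<in>UNIV. M' a $ i $ p i * of_bool (p = id)))) (at x)"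
    by (rule has_derivative_sum, rule has_derivative_eq_rhs[OF has_derivative_mult_right[OF has_derivative_prod[OF c]]])
       (simp add: z)
  moreover have "(\<Sum>p | p permutes (UNIV::'n set). of_int (sign p) * (\<Sum>i\<in>UNIV. M' a $ i $ p i * of_bool (p = id)))
      = (\<Sum>i\<in>UNIV. M' a $ i $ i)" for a
    by (subst sum.remove[of _ id]) (auto simp: finite_permutations permutes_id sign_id intro!: sum.neutral)
  ultimately show ?thesis unfolding det_def by simp
qed

text \<open>Multiplication by the fixed inverse of \<open>M x\<close> moves the base point to the
  identity matrix.\<close>

lemma has_derivative_det:
  fixes M :: "'a::real_normed_vector \<Rightarrow> real^'n::finite^'n"
  assumes M: "(M has_derivative M') (at x)" and inv: "invertible (M x)"
  shows "((\<lambda>x. det (M x)) has_derivative (\<lambda>a. det (M x) * (\<Sum>i\<in>UNIV. (matrix_inv (M x) ** M' a) $ i $ i))) (at x)"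
proof -
  let ?I = "matrix_inv (M x)"
  have I: "M x ** ?I = mat 1" "?I ** M x = mat 1"
    using inv unfolding matrix_inv_def invertible_def by (metis (mono_tags, lifting) someI_ex)+
  have bl: "bounded_linear (\<lambda>A. ?I ** A)"
    by (rule linear_conv_bounded_linear[THEN iffD1])
      (auto intro!: linearI simp: matrix_add_ldistrib matrix_matrix_mult_def vec_eq_iff sum_distrib_left sum.distrib distrib_left ac_simps)
  have "((\<lambda>x. det (?I ** M x)) has_derivative (\<lambda>a. \<Sum>i\<in>UNIV. (?I ** M' a) $ i $ i)) (at x)"
    by (rule has_derivative_det_at_mat1[OF bounded_linear.has_derivative[OF bl M]]) (rule I)
  from has_derivative_mult_right[OF this, of "det (M x)"]
  have "((\<lambda>y. det (M x) * det (?I ** M y)) has_derivative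
    (\<lambda>a. det (M x) * (\<Sum>i\<in>UNIV. (?I ** M' a) $ i $ i))) (at x)" .
  moreover have "det (M x) * det (?I ** M y) = det (M y)" for y
    using arg_cong[OF I(1), of det] by (simp add: det_mul algebra_simps)
  ultimately show ?thesis by simp
qed

section \<open>The S-curvature of a Randers metric\<close>

context randers_data
begin

text \<open>The quadratic h(y - r W, y - r W) - r^2 in r vanishes at r = F, and its value at r = 1
  is F - 1 times a positive number. Thus the unit ball of F is the h-ball translated by
  \<open>W\<close>, an ellipsoid.\<close>

lemma F_less_1_iff:
  assumes x: "x \<in> U"
  shows "F x y < 1 \<longleftrightarrow> bf (h x) (y - W x) (y - W x) < 1"
proof (cases "y = 0")
  case True
  then show ?thesis using W_small[OF x] F_zero[OF x] by simp
next
  case False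
  define l w0 f where "l = 1 - bf (h x) (W x) (W x)" and "w0 = bf (h x) y (W x)" and "f = F x y"
  have l: "l > 0" using W_small[OF x] by (simp add: l_def)
  have f: "f > 0" using F_pos[OF x False] by (simp add: f_def)
  have q: "bf (h x) (y - r *\<^sub>R W x) (y - r *\<^sub>R W x) - r\<^sup>2 = bf (h x) y y - r * (2 * w0 + l * r)" for r
    using h_comm[OF x, of "W x" y] by (simp add: l_def w0_def algebra_simps power2_eq_square)
  have "bf (h x) y y = f * (2 * w0 + l * f)"
    using q[of f] navigation[OF x, of y] by (simp add: \<eta>_def f_def)
  then have "f * (2 * w0 + l * f) > 0" using h_pos[OF x False] by simp
  then have "2 * w0 + l * f > 0" using f by (simp add: zero_less_mult_iff)
  then have pos: "2 * w0 + l * f + l > 0" using l by simp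
  have "bf (h x) (y - W x) (y - W x) - 1 = (f - 1) * (2 * w0 + l * f + l)"
    using q[of 1] \<open>bf (h x) y y = _\<close> by (simp add: algebra_simps)
  then have "bf (h x) (y - W x) (y - W x) < 1 \<longleftrightarrow> (f - 1) * (2 * w0 + l * f + l) < 0" by linarith
  also have "\<dots> \<longleftrightarrow> f < 1" using pos by (simp add: mult_less_0_iff)
  finally show ?thesis by (simp add: f_def)
qed

lemma BH_density_eq:
  assumes x: "x \<in> U" shows "BH_density F x = sqrt (det (h x))" "det (h x) > 0"
proof -
  show d: "det (h x) > 0" by (rule measure_ellipsoid(1)[OF h_sym[OF x]]) (rule h_pos[OF x])
  have e: "measure lebesgue {v. bf (h x) (v - W x) (v - W x) < 1}
      = measure lebesgue (ball (0::real^'n) 1) / sqrt (det (h x))"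
    by (rule measure_ellipsoid(2)[OF h_sym[OF x]]) (rule h_pos[OF x])
  have "measure lebesgue (ball (0::real^'n) 1) > 0"
    using content_ball_pos[of 1 "0::real^'n"] by (simp add: measure_completion)
  then show "BH_density F x = sqrt (det (h x))"
    unfolding BH_density_def F_less_1_iff[OF x] e using d by simp
qed

lemma partial_ln_BH:
  assumes x: "x \<in> U"
  shows "partial i (\<lambda>x. ln (BH_density F x)) x = tr x (bf (Dh x (axis i 1))) / 2"
proof -
  have d: "det (h x) > 0" by (rule BH_density_eq(2)[OF x])
  have "((\<lambda>x. ln (det (h x))) has_derivative
      (\<lambda>a. \<Sum>i\<in>UNIV. (matrix_inv (h x) ** Dh x a) $ i $ i)) (at x)"
    by (rule has_derivative_eq_rhs[OF has_derivative_ln[OF d has_derivative_det[OF h_deriv[OF x] h_invertible[OF x]]]])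
       (use d in \<open>simp add: fun_eq_iff\<close>)
  from has_derivative_mult_right[OF this, of "1/2"]
  have "((\<lambda>x. ln (BH_density F x)) has_derivative
      (\<lambda>a. 1/2 * (\<Sum>i\<in>UNIV. (matrix_inv (h x) ** Dh x a) $ i $ i))) (at x)"
    by (rule has_derivative_transform_within_open[OF _ open_U x])
       (use ln_sqrt[OF less_imp_le[OF BH_density_eq(2)]] in \<open>simp add: BH_density_eq(1)\<close>)
  moreover have "(\<Sum>i\<in>UNIV. (matrix_inv (h x) ** Dh x a) $ i $ i) = tr x (bf (Dh x a))" for a
    using Dh_comm[OF x, of a "axis _ 1" "axis _ 1"] by (simp add: tr_def matrix_matrix_mult_def bf_axis)
  ultimately show ?thesis by (simp add: partial_eq)
qed

text \<open>By Jacobi's formula the density contributes half the trace of \<open>Dh x y\<close>,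
  which cancels the same term in the trace of the nonlinear connection.\<close>

lemma S_curvature_eq:
  assumes x: "x \<in> U" and y: "y \<noteq> 0"
  shows "S_curvature F (BH_density F) x y = - (real CARD('n) + 1) / 2 * R x (\<eta> x y) (\<eta> x y) / F x y"
proof -
  have "linear (\<lambda>a. tr x (bf (Dh x a)))"
    by (rule linearI) (simp_all add: tr_def Dh_lin[OF x] algebra_simps sum.distrib sum_distrib_left)
  from linear_expand[OF this, of y]
  have "(\<Sum>i\<in>UNIV. y $ i * partial i (\<lambda>x. ln (BH_density F x)) x) = tr x (bf (Dh x y)) / 2"
    by (simp add: partial_ln_BH[OF x] sum_divide_distrib)
  moreover have "(\<Sum>i\<in>UNIV. partial i (spray F i x) y) = (\<Sum>i\<in>UNIV. dGv x y (axis i 1) $ i)"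
    by (simp add: nonlin_conn_eq[OF x y] flip: nonlin_conn_def)
  moreover define q where "q = (real CARD('n) + 1) * R x (\<eta> x y) (\<eta> x y) / F x y"
  have "- (real CARD('n) + 1) / 2 * R x (\<eta> x y) (\<eta> x y) / F x y = - q / 2"
    using F_pos[OF x y] by (simp add: q_def field_simps)
  ultimately show ?thesis
    using trace_dGv[OF x y, folded q_def] unfolding S_curvature_def by linarith
qed

text \<open>Every nonzero vector is \<open>\<eta> x y\<close> for some \<open>y\<close>, so S determines the quadratic form of \<open>R x\<close>.\<close>

lemma R_of_isotropic:
  assumes x: "x \<in> U"
    and iso: "\<And>y. y \<noteq> 0 \<Longrightarrow> S_curvature F (BH_density F) x y = (real CARD('n) + 1) * \<kappa> * F x y"
  shows "R x X Z = - 2 * \<kappa> * bf (h x) X Z"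
proof -
  have diag: "R x e e = - 2 * \<kappa> * bf (h x) e e" for e
  proof (cases "e = 0")
    case False
    define r where "r = sqrt (bf (h x) e e)"
    have r: "r > 0" "r\<^sup>2 = bf (h x) e e" using h_pos[OF x False] by (simp_all add: r_def)
    \<comment> \<open>\<open>F\<close> has to be the h-length of \<open>\<eta>\<close>, so this is
      the only candidate with \<open>\<eta> x y = e\<close>.\<close>
    define y where "y = e + r *\<^sub>R W x"
    \<comment> \<open>Otherwise \<open>e = - (r *\<^sub>R W x)\<close> would have h-length below
      \<open>r\<close>.\<close>
    have y: "y \<noteq> 0"
    proof
      assume "y = 0"
      then have e: "e = - (r *\<^sub>R W x)" by (simp add: y_def eq_neg_iff_add_eq_0)
      have "r\<^sup>2 = r\<^sup>2 * bf (h x) (W x) (W x)" unfolding r(2) by (subst (1 2) e) (simp add: r(2)[symmetric] power2_eq_square)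
      then show False using r(1) W_small[OF x] by simp
    qed
    have "y - r *\<^sub>R W x = e" by (simp add: y_def)
    then have "bf (h x) (y - r *\<^sub>R W x) (y - r *\<^sub>R W x) = r\<^sup>2" using r(2) by (simp only:)
    then have F: "F x y = r" using F_unique[OF x less_imp_le[OF r(1)] y] by simp
    have "\<eta> x y = e" unfolding \<eta>_def F by (simp add: y_def)
    then have "- (real CARD('n) + 1) / 2 * R x e e / r = (real CARD('n) + 1) * \<kappa> * r"
      using S_curvature_eq[OF x y] iso[OF y] F by simp
    then have "(real CARD('n) + 1) * (R x e e + 2 * \<kappa> * r\<^sup>2) = 0"
      using r(1) by (simp add: field_simps power2_eq_square)
    then show ?thesis using r(2) by (simp add: add_eq_0_iff)
  qed (simp add: R_def DW_lin[OF x])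
  \<comment> \<open>Polarisation.\<close>
  show ?thesis
    using diag[of "X + Z"] diag[of X] diag[of Z] R_comm[OF x, of Z X] h_comm[OF x, of Z X]
    by (simp add: R_lin[OF x] algebra_simps)
qed

end

section \<open>Closure properties of smooth maps\<close>

lemma Ck_on_derivD:
  "Ck_on (Suc k) S f \<Longrightarrow> x \<in> S \<Longrightarrow> (f has_derivative frechet_derivative f (at x)) (at x)"
  "Ck_on (Suc k) S f \<Longrightarrow> Ck_on k S (\<lambda>x. frechet_derivative f (at x) v)"
  by (auto simp: frechet_derivative_works)

lemma Ck_on_cong:
  assumes S: "open S" and "\<And>x. x \<in> S \<Longrightarrow> f x = g x" "Ck_on k S f"
  shows "Ck_on k S g"
  using assms(2,3)
proof (induction k arbitrary: f g)
  case 0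
  then show ?case by (simp cong: continuous_on_cong)
next
  case (Suc k)
  have g: "(g has_derivative frechet_derivative f (at x)) (at x)" if "x \<in> S" for x
    by (rule has_derivative_transform_within_open[OF Ck_on_derivD(1)[OF Suc.prems(2) that] S that Suc.prems(1)])
  have "frechet_derivative f (at x) v = frechet_derivative g (at x) v" if "x \<in> S" for x v
    using frechet_derivative_at[OF g[OF that]] by simp
  then have "Ck_on k S (\<lambda>x. frechet_derivative g (at x) v)" for v
    by (rule Suc.IH[OF _ Ck_on_derivD(2)[OF Suc.prems(2)]])
  then show ?case using g by (auto simp: differentiable_def)
qed

text \<open>Lets the derivative be given by any formula instead of
  \<open>frechet_derivative\<close>; the inductive closure proofs below rest on it.\<close>

lemma Ck_on_SucI:
  assumes S: "open S" and f: "\<And>x. x \<in> S \<Longrightarrow> (f has_derivative f' x) (at x)"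
    and f': "\<And>v. Ck_on k S (\<lambda>x. f' x v)"
  shows "Ck_on (Suc k) S f"
proof -
  have "f' x v = frechet_derivative f (at x) v" if "x \<in> S" for x v
    using frechet_derivative_at[OF f[OF that]] by simp
  then have "Ck_on k S (\<lambda>x. frechet_derivative f (at x) v)" for v
    by (rule Ck_on_cong[OF S _ f'])
  then show ?thesis using f by (auto simp: differentiable_def)
qed

lemma Ck_on_SucD: "Ck_on (Suc k) S f \<Longrightarrow> Ck_on k S f"
proof (induction k arbitrary: f)
  case 0
  then show ?case
    by (auto intro!: continuous_at_imp_continuous_on differentiable_imp_continuous_within)
next
  case (Suc k)
  then show ?case by simp
qed

lemma Ck_on_subset: "Ck_on k S f \<Longrightarrow> T \<subseteq> S \<Longrightarrow> Ck_on k T f"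
  by (induction k arbitrary: f) (auto intro: continuous_on_subset)

lemma Ck_on_continuous: "Ck_on k S f \<Longrightarrow> continuous_on S f"
  by (induction k) (auto dest: Ck_on_SucD simp del: Ck_on.simps(2))

context
  fixes S :: "'a::real_normed_vector set"
  assumes S: "open S"
begin

lemma Ck_on_const: "Ck_on k S (\<lambda>x. c)"
proof (induction k arbitrary: c)
  case (Suc k)
  then show ?case by (intro Ck_on_SucI[OF S has_derivative_const])
qed simp

lemma Ck_on_bounded_linear:
  assumes B: "bounded_linear B" and "Ck_on k S f"
  shows "Ck_on k S (\<lambda>x. B (f x))"
  using assms(2)
proof (induction k arbitrary: f)
  case 0
  then show ?case using bounded_linear.continuous_on[OF B] by simp
next
  case (Suc k)
  show ?case
    by (rule Ck_on_SucI[OF S bounded_linear.has_derivative[OF B Ck_on_derivD(1)[OF Suc.prems]]])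
       (use Suc in auto)
qed

lemma Ck_on_add:
  assumes "Ck_on k S f" "Ck_on k S g"
  shows "Ck_on k S (\<lambda>x. f x + g x)"
  using assms
proof (induction k arbitrary: f g)
  case 0
  then show ?case by (auto intro: continuous_on_add)
next
  case (Suc k)
  show ?case
    by (rule Ck_on_SucI[OF S has_derivative_add[OF Ck_on_derivD(1)[OF Suc.prems(1)] Ck_on_derivD(1)[OF Suc.prems(2)]]])
       (use Suc in auto)
qed

lemma Ck_on_bilinear:
  assumes B: "bounded_bilinear B" and "Ck_on k S f" "Ck_on k S g"
  shows "Ck_on k S (\<lambda>x. B (f x) (g x))"
  using assms(2,3)
proof (induction k arbitrary: f g)
  case 0
  then show ?case using bounded_bilinear.continuous_on[OF B] by simp
next
  case (Suc k)
  show ?case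
    by (rule Ck_on_SucI[OF S bounded_bilinear.FDERIV[OF B Ck_on_derivD(1)[OF Suc.prems(1)] Ck_on_derivD(1)[OF Suc.prems(2)]]])
       (intro Ck_on_add Suc.IH Ck_on_derivD(2)[OF Suc.prems(1)] Ck_on_derivD(2)[OF Suc.prems(2)]
          Ck_on_SucD[OF Suc.prems(1)] Ck_on_SucD[OF Suc.prems(2)] | assumption)+
qed

lemmas Ck_on_mult = Ck_on_bilinear[OF bounded_bilinear_mult]
lemmas Ck_on_scaleR = Ck_on_bilinear[OF bounded_bilinear_scaleR]

lemma Ck_on_minus: "Ck_on k S f \<Longrightarrow> Ck_on k S (\<lambda>x. - f x)"
  by (rule Ck_on_bounded_linear) (rule bounded_linear_minus[OF bounded_linear_ident])

lemma Ck_on_sum: "(\<And>i. i \<in> I \<Longrightarrow> Ck_on k S (f i)) \<Longrightarrow> Ck_on k S (\<lambda>x. \<Sum>i\<in>I. f i x)"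
  by (induction I rule: infinite_finite_induct) (auto intro: Ck_on_add Ck_on_const)

lemma Ck_on_prod:
  fixes f :: "'i \<Rightarrow> 'a \<Rightarrow> real"
  shows "(\<And>i. i \<in> I \<Longrightarrow> Ck_on k S (f i)) \<Longrightarrow> Ck_on k S (\<lambda>x. \<Prod>i\<in>I. f i x)"
  by (induction I rule: infinite_finite_induct) (auto intro: Ck_on_mult Ck_on_const)

lemma Ck_on_inverse:
  fixes f :: "'a \<Rightarrow> real"
  assumes nz: "\<And>x. x \<in> S \<Longrightarrow> f x \<noteq> 0" and "Ck_on k S f"
  shows "Ck_on k S (\<lambda>x. inverse (f x))"
  using assms(2)
proof (induction k)
  case 0
  then show ?case using nz by (auto intro: continuous_on_inverse)
next
  case (Suc k)
  show ?case
    by (rule Ck_on_SucI[OF S Deriv.has_derivative_inverse[OF nz Ck_on_derivD(1)[OF Suc.prems]]])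
       (intro Ck_on_mult Ck_on_minus Suc.IH Ck_on_derivD(2)[OF Suc.prems] Ck_on_SucD[OF Suc.prems] | assumption)+
qed

lemma Ck_on_sqrt:
  fixes f :: "'a \<Rightarrow> real"
  assumes pos: "\<And>x. x \<in> S \<Longrightarrow> f x > 0" and "Ck_on k S f"
  shows "Ck_on k S (\<lambda>x. sqrt (f x))"
  using assms(2)
proof (induction k)
  case 0
  then show ?case by (auto intro: continuous_on_real_sqrt)
next
  case (Suc k)
  have d: "((\<lambda>x. sqrt (f x)) has_derivative
      (\<lambda>v. frechet_derivative f (at x) v * (inverse (sqrt (f x)) / 2))) (at x)" if "x \<in> S" for x
    by (rule has_derivative_eq_rhs[OF has_derivative_real_sqrt[OF pos[OF that] Ck_on_derivD(1)[OF Suc.prems that]]])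
       (simp add: fun_eq_iff)
  have i: "Ck_on k S (\<lambda>x. inverse (sqrt (f x)))"
    by (rule Ck_on_inverse) (use pos Suc.IH[OF Ck_on_SucD[OF Suc.prems]] in force)+
  show ?case
    by (rule Ck_on_SucI[OF S d]) (auto simp only: divide_inverse
        intro!: Ck_on_mult i Ck_on_const Ck_on_derivD(2)[OF Suc.prems])
qed

lemma Ck_on_component: "Ck_on k S f \<Longrightarrow> Ck_on k S (\<lambda>x. f x $ i)"
  by (rule Ck_on_bounded_linear[OF bounded_linear_vec_nth])

lemma Ck_on_det:
  fixes M :: "'a \<Rightarrow> real^'i::finite^'i"
  assumes "\<And>i j. Ck_on k S (\<lambda>x. M x $ i $ j)" shows "Ck_on k S (\<lambda>x. det (M x))"
  unfolding det_def by (intro Ck_on_sum Ck_on_mult Ck_on_const Ck_on_prod assms)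

text \<open>The chain rule evaluates the derivative of \<open>g\<close> in the moving direction
  f'(x) v, while \<open>Ck_on\<close> speaks of fixed directions; expansion in the standard basis
  reduces to these.\<close>

lemma Ck_on_compose:
  fixes g :: "real^'n::finite \<Rightarrow> 'b::real_normed_vector"
  assumes T: "open T" and "Ck_on k T g" "Ck_on k S f" and fT: "\<And>x. x \<in> S \<Longrightarrow> f x \<in> T"
  shows "Ck_on k S (\<lambda>x. g (f x))"
  using assms(2,3)
proof (induction k arbitrary: g)
  case 0
  then show ?case using fT by (auto intro: continuous_on_compose2[of T g S f])
next
  case (Suc k)
  let ?g' = "\<lambda>y. frechet_derivative g (at y)" and ?f' = "\<lambda>x. frechet_derivative f (at x)"
  have d: "((\<lambda>x. g (f x)) has_derivative (\<lambda>v. \<Sum>i\<in>UNIV. (?f' x v $ i) *\<^sub>R ?g' (f x) (axis i 1))) (at x)"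
    if x: "x \<in> S" for x
  proof (rule has_derivative_eq_rhs[OF has_derivative_compose[OF Ck_on_derivD(1)[OF Suc.prems(2) x]
          Ck_on_derivD(1)[OF Suc.prems(1) fT[OF x]]]], rule ext)
    fix v
    have l: "linear (?g' (f x))" using Ck_on_derivD(1)[OF Suc.prems(1) fT[OF x]] has_derivative_linear by blast
    have "?g' (f x) (?f' x v) = ?g' (f x) (\<Sum>i\<in>UNIV. (?f' x v $ i) *\<^sub>R axis i 1)"
      using basis_expansion[of "?f' x v"] by (simp add: scalar_mult_eq_scaleR)
    then show "?g' (f x) (?f' x v) = (\<Sum>i\<in>UNIV. (?f' x v $ i) *\<^sub>R ?g' (f x) (axis i 1))"
      by (simp add: linear_sum[OF l] linear_scale[OF l])
  qed
  show ?case
    by (rule Ck_on_SucI[OF S d])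
       (intro Ck_on_sum Ck_on_scaleR Ck_on_component Ck_on_derivD(2)[OF Suc.prems(2)]
          Suc.IH[OF Ck_on_derivD(2)[OF Suc.prems(1)] Ck_on_SucD[OF Suc.prems(2)]] | assumption)+
qed

lemma Ck_on_bf:
  assumes "Ck_on k S A" "Ck_on k S u" "Ck_on k S v"
  shows "Ck_on k S (\<lambda>x. bf (A x) (u x) (v x))"
  unfolding bf_def
  by (intro Ck_on_bilinear[OF bounded_bilinear_inner] Ck_on_bilinear[OF bounded_bilinear_matrix_vector] assms)

end

section \<open>Existence of normal sections\<close>

lemma smooth_on_frechet: "smooth_on S f \<Longrightarrow> smooth_on S (\<lambda>x. frechet_derivative f (at x) v)"
  by (metis Ck_on_derivD(2) smooth_on_def)

lemma smooth_on_subset: "smooth_on S f \<Longrightarrow> T \<subseteq> S \<Longrightarrow> smooth_on T f"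
  by (metis Ck_on_subset smooth_on_def)

lemma smooth_on_compose:
  fixes g :: "real^'n::finite \<Rightarrow> 'b::real_normed_vector"
  shows "open S \<Longrightarrow> open T \<Longrightarrow> smooth_on T g \<Longrightarrow> smooth_on S f \<Longrightarrow> (\<And>x. x \<in> S \<Longrightarrow> f x \<in> T)
    \<Longrightarrow> smooth_on S (\<lambda>x. g (f x))"
  by (simp add: smooth_on_def Ck_on_compose)

lemma smooth_on_has_derivative:
  "smooth_on S f \<Longrightarrow> x \<in> S \<Longrightarrow> (f has_derivative frechet_derivative f (at x)) (at x)"
  by (meson Ck_on_derivD(1) smooth_on_def)

text \<open>The constant vector \<open>n\<close> is projected onto the h-normal spaces and
  normalised where the projection is nonzero. Cramer's rule writes the coefficients of the
  tangential part as quotients of determinants, so smoothness reduces to closure properties.\<close>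

lemma (in randers_data) riem_section_exists:
  fixes f :: "real^'m::finite \<Rightarrow> real^'n"
  assumes V: "open V" "s \<in> V" and f: "smooth_on V f" and fU: "\<And>t. t \<in> V \<Longrightarrow> f t \<in> U"
    and inj: "\<And>t. t \<in> V \<Longrightarrow> inj (frechet_derivative f (at t))"
    and h: "smooth_on U h" and n: "riem_unit_normal h f s n"
  shows "\<exists>\<nu>. local_section (riem_unit_normal h f) V s n \<nu>"
proof -
  define L where "L t = frechet_derivative f (at t)" for t
  have L: "linear (L t)" if "t \<in> V" for t
    using smooth_on_has_derivative[OF f that] has_derivative_linear unfolding L_def by blast
  define G where "G t = (\<chi> i j. bf (h (f t)) (L t (axis i 1)) (L t (axis j 1)))" for t
  define b where "b t = (\<chi> i. bf (h (f t)) n (L t (axis i 1)))" for t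
  define v where "v t = (\<chi> k. det (\<chi> i j. if j = k then b t $ i else G t $ i $ j) / det (G t))" for t
  define \<xi> where "\<xi> t = n - (\<Sum>k\<in>UNIV. v t $ k *\<^sub>R L t (axis k 1))" for t
  define N where "N t = bf (h (f t)) (\<xi> t) (\<xi> t)" for t
  define S where "S = V \<inter> N -` {0<..}"
  define \<nu> where "\<nu> t = inverse (sqrt (N t)) *\<^sub>R \<xi> t" for t
  have G_bf: "bf (G t) w u = bf (h (f t)) (L t w) (L t u)" if "t \<in> V" for t w u
    unfolding G_def
    by (rule bf_of_bilinear) (auto intro!: linearI simp: linear_add[OF L[OF that]] linear_scale[OF L[OF that]])
  have G_det: "det (G t) \<noteq> 0" if t: "t \<in> V" for t
  proof -
    have "invertible (G t)"
    proof (rule invertible_of_kernel)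
      fix u assume "\<And>w. bf (G t) w u = 0"
      then have "bf (h (f t)) (L t u) (L t u) = 0" using G_bf[OF t] by simp
      then have "L t u = 0" using h_pos[OF fU[OF t], of "L t u"] by (metis less_irrefl)
      then show "u = 0"
        using inj[OF t] linear_injective_0[OF L[OF t]] by (simp add: L_def)
    qed
    then show ?thesis by (simp add: invertible_det_nz)
  qed
  have Gv: "G t *v w = b t \<longleftrightarrow> w = v t" if "t \<in> V" for t w
    unfolding v_def using cramer[OF G_det[OF that]] by simp
  have Lv: "(\<Sum>k\<in>UNIV. v t $ k *\<^sub>R L t (axis k 1)) = L t (v t)" if t: "t \<in> V" for t
    using basis_expansion[of "v t"] linear_sum[OF L[OF t], of "\<lambda>k. v t $ k *\<^sub>R axis k 1" UNIV]
    by (simp add: scalar_mult_eq_scaleR linear_scale[OF L[OF t]])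
  have orth: "bf (h (f t)) (\<xi> t) (L t u) = 0" if t: "t \<in> V" for t u
  proof -
    have "bf (h (f t)) (L t u) n = bf (h (f t)) n (L t u)" by (rule h_comm[OF fU[OF t]])
    also have "\<dots> = (\<Sum>i\<in>UNIV. u $ i * b t $ i)"
      unfolding b_def vec_lambda_beta
      by (rule linear_expand) (auto intro!: linearI simp: linear_add[OF L[OF t]] linear_scale[OF L[OF t]])
    also have "\<dots> = bf (G t) u (v t)"
      using Gv[OF t, of "v t"] by (simp add: bf_def inner_vec_def)
    also have "\<dots> = bf (h (f t)) (L t u) (L t (v t))" by (rule G_bf[OF t])
    finally have "bf (h (f t)) (L t u) (\<xi> t) = 0" by (simp add: \<xi>_def Lv[OF t])
    then show ?thesis using h_comm[OF fU[OF t], of "\<xi> t" "L t u"] by simp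
  qed
  have smV: "Ck_on k V (\<lambda>t. h (f t))" "Ck_on k V (\<lambda>t. L t u)" for k u
    using smooth_on_compose[OF V(1) open_U h f fU] smooth_on_frechet[OF f]
    unfolding smooth_on_def L_def by blast+
  have Gs: "Ck_on k V (\<lambda>t. G t $ i $ j)" for k i j
    unfolding G_def vec_lambda_beta by (intro Ck_on_bf V smV)
  have bs: "Ck_on k V (\<lambda>t. b t $ i)" for k i
    unfolding b_def vec_lambda_beta by (intro Ck_on_bf Ck_on_const V smV)
  have vs: "Ck_on k V (\<lambda>t. v t $ i)" for k i
  proof -
    have "Ck_on k V (\<lambda>t. if j = i then b t $ i' else G t $ i' $ j)" for i' j
      by (cases "j = i") (simp_all add: Gs bs)
    then have d: "Ck_on k V (\<lambda>t. det (\<chi> i' j. if j = i then b t $ i' else G t $ i' $ j))"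
      by (intro Ck_on_det[OF V(1)]) simp
    show ?thesis
      unfolding v_def vec_lambda_beta divide_inverse
      by (rule Ck_on_mult[OF V(1) d Ck_on_inverse[OF V(1) G_det Ck_on_det[OF V(1) Gs]]])
  qed
  have \<xi>s: "Ck_on k V \<xi>" for k
  proof -
    have "Ck_on k V (\<lambda>t. n + - (\<Sum>k\<in>UNIV. v t $ k *\<^sub>R L t (axis k 1)))"
      by (intro Ck_on_add Ck_on_minus Ck_on_sum Ck_on_scaleR Ck_on_const V vs smV)
    moreover have "\<xi> = (\<lambda>t. n + - (\<Sum>k\<in>UNIV. v t $ k *\<^sub>R L t (axis k 1)))"
      by (simp add: fun_eq_iff \<xi>_def)
    ultimately show ?thesis by (simp only:)
  qed
  have Ns: "Ck_on k V N" for k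
    unfolding N_def by (intro Ck_on_bf V smV \<xi>s)
  have S: "open S" "S \<subseteq> V" and NS: "\<And>t. t \<in> S \<Longrightarrow> N t > 0"
    unfolding S_def using continuous_open_preimage[OF Ck_on_continuous[OF Ns] V(1), of "{0<..}"] by auto
  have \<nu>s: "Ck_on k S \<nu>" for k
  proof -
    have "Ck_on k S (\<lambda>t. inverse (sqrt (N t)))"
    proof (rule Ck_on_inverse[OF S(1)])
      show "sqrt (N t) \<noteq> 0" if "t \<in> S" for t using NS[OF that] by simp
      show "Ck_on k S (\<lambda>t. sqrt (N t))"
        by (rule Ck_on_sqrt[OF S(1) NS Ck_on_subset[OF Ns S(2)]])
    qed
    then show ?thesis
      unfolding \<nu>_def by (intro Ck_on_scaleR S Ck_on_subset[OF \<xi>s S(2)])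
  qed
  \<comment> \<open>At \<open>s\<close> the vector \<open>n\<close> is already a unit normal, so
    projection and normalisation leave it unchanged.\<close>
  have "b s = 0"
    using n by (simp add: b_def riem_unit_normal_def bf_def[symmetric] L_def vec_eq_iff)
  then have "v s = 0" using Gv[OF V(2), of 0] by simp
  then have \<xi>0: "\<xi> s = n" by (simp add: \<xi>_def)
  then have N0: "N s = 1" using n by (simp add: N_def riem_unit_normal_def bf_def)
  have "riem_unit_normal h f t (\<nu> t)" if t: "t \<in> S" for t
  proof -
    have "t \<in> V" using t S by blast
    have "bf (h (f t)) (\<nu> t) (\<nu> t) = (inverse (sqrt (N t)))\<^sup>2 * N t"
      by (simp add: \<nu>_def N_def power2_eq_square)
    then have "bf (h (f t)) (\<nu> t) (\<nu> t) = 1" using NS[OF t] by (simp add: power_inverse)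
    moreover have "bf (h (f t)) (\<nu> t) (L t u) = 0" for u
      by (simp add: \<nu>_def orth[OF \<open>t \<in> V\<close>])
    ultimately show ?thesis unfolding riem_unit_normal_def bf_def[symmetric] L_def by simp
  qed
  then have "local_section (riem_unit_normal h f) V s n \<nu>"
    unfolding local_section_def smooth_on_def
    using S \<nu>s V(2) N0 \<xi>0 by (auto simp: \<nu>_def S_def intro!: exI[of _ S])
  then show ?thesis by blast
qed

section \<open>Comparison of the shape operators\<close>

lemma local_section_differentiable:
  "local_section P V s n \<nu> \<Longrightarrow> \<nu> differentiable (at s)"
  unfolding local_section_def using smooth_on_has_derivative differentiableI by blast

lemma smooth_on_add: "open S \<Longrightarrow> smooth_on S f \<Longrightarrow> smooth_on S g \<Longrightarrow> smooth_on S (\<lambda>x. f x + g x)"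
  by (simp add: smooth_on_def Ck_on_add)

context randers_data
begin

context
  fixes f :: "real^'m::finite \<Rightarrow> real^'n" and V s n
  assumes V: "open V" "s \<in> V" and f: "smooth_on V f" and fU: "\<And>t. t \<in> V \<Longrightarrow> f t \<in> U"
    and inj: "\<And>t. t \<in> V \<Longrightarrow> inj (frechet_derivative f (at t))"
    and h: "smooth_on U h" and W: "smooth_on U W" and n: "unit_normal F f s n"
begin

text \<open>Ensures that the \<open>SOME\<close> in \<open>riem_shape_operator\<close> selects a
  genuine section.\<close>

lemma riem_normal_section:
  "local_section (riem_unit_normal h f) V s (n - W (f s)) (SOME \<nu>. local_section (riem_unit_normal h f) V s (n - W (f s)) \<nu>)"
  by (rule someI_ex[of "local_section (riem_unit_normal h f) V s (n - W (f s))"],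
      intro riem_section_exists[OF V f fU inj h])
     (use n unit_normal_iff[of f s n, OF fU[OF V(2)]] in simp_all)

text \<open>Adding \<open>W\<close> turns Riemannian unit normal sections into Randers ones.\<close>

lemma randers_normal_section:
  "local_section (unit_normal F f) V s n (SOME \<nu>. local_section (unit_normal F f) V s n \<nu>)"
proof -
  obtain \<mu> S where \<mu>: "\<mu> s = n - W (f s)" and S: "open S" "s \<in> S" "S \<subseteq> V" "smooth_on S \<mu>"
    and nr: "\<And>t. t \<in> S \<Longrightarrow> riem_unit_normal h f t (\<mu> t)"
    using riem_normal_section unfolding local_section_def by blast
  have "smooth_on S (\<lambda>t. W (f t))"
    by (rule smooth_on_compose[OF S(1) open_U W smooth_on_subset[OF f S(3)]]) (use S fU in blast)
  then have "smooth_on S (\<lambda>t. \<mu> t + W (f t))" by (rule smooth_on_add[OF S(1,4)])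
  moreover have "unit_normal F f t (\<mu> t + W (f t))" if "t \<in> S" for t
    using nr[OF that] unit_normal_iff[of f t "\<mu> t + W (f t)"] fU S(3) that by auto
  ultimately have "local_section (unit_normal F f) V s n (\<lambda>t. \<mu> t + W (f t))"
    unfolding local_section_def using \<mu> S by auto
  then show ?thesis by (rule someI[of "local_section (unit_normal F f) V s n"])
qed

text \<open>On tangent vectors \<open>cc\<close> times g is \<open>h\<close>, so pairing both
  covariant derivatives with all tangent vectors compares their tangential parts. These differ by
  \<open>- \<kappa> *\<^sub>R u\<close>, and the minus sign in the shape operators makes it
  \<open>+ \<kappa> *\<^sub>R u\<close>.\<close>

lemma shape_operator_eq:
  assumes iso: "\<And>y. y \<noteq> 0 \<Longrightarrow> S_curvature F (BH_density F) (f s) y = (real CARD('n) + 1) * \<kappa> * F (f s) y"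
  shows "shape_operator F f V s n u = riem_shape_operator h f V s (n - W (f s)) u + \<kappa> *\<^sub>R u"
proof -
  define L where "L = frechet_derivative f (at s)"
  define x where "x = f s"
  define e where "e = n - W x"
  define \<nu> where "\<nu> = (SOME \<nu>. local_section (unit_normal F f) V s n \<nu>)"
  define \<mu> where "\<mu> = (SOME \<nu>. local_section (riem_unit_normal h f) V s (n - W (f s)) \<nu>)"
  have \<nu>: "local_section (unit_normal F f) V s n \<nu>"
    unfolding \<nu>_def by (rule randers_normal_section)
  have \<mu>: "local_section (riem_unit_normal h f) V s (n - W (f s)) \<mu>"
    unfolding \<mu>_def by (rule riem_normal_section)
  have x: "x \<in> U" using fU[OF V(2)] by (simp add: x_def)
  have n0: "n \<noteq> 0" by (rule unit_normal_nonzero[OF fU[OF V(2)] n])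
  note un = unit_normal_ell[OF fU[OF V(2)] n, folded x_def L_def, folded e_def]
  have c: "cc x n > 0" by (rule cc_pos[OF x n0])
  have ee: "bf (h x) e e = 1" using navigation[OF x, of n] un by simp
  have fd: "f differentiable (at s)" using smooth_on_has_derivative[OF f V(2)] differentiableI by blast
  have L: "linear L"
    using smooth_on_has_derivative[OF f V(2)] has_derivative_linear unfolding L_def by blast
  have hpos: "v = 0" if "bf (h x) (L v) (L v) = 0" for v
  proof -
    have "L v = 0" using h_pos[OF x, of "L v"] that by (metis less_irrefl)
    then show ?thesis using inj[OF V(2)] linear_injective_0[OF L] by (simp add: L_def)
  qed
  have gL: "cc x n * gm x n (L v) (L w) = bf (h x) (L v) (L w)" for v w
    using gm_tangent[OF x un(2) un(2), of v w] c by (simp add: un(1))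
  define a where "a = cov_along (christoffel h x) f \<mu> s u"
  define b where "b = cov_along (chern F x n) f \<nu> s u"
  \<comment> \<open>The correction R - R(e, e)/2 h has the factor -2 \<kappa> + \<kappa>, because
    h(e, e) = 1.\<close>
  have ab: "cc x n * gm x n b (L v) = bf (h x) a (L v) - \<kappa> * bf (h x) (L u) (L v)" for v
  proof -
    note f2 = smooth_on_has_derivative[OF smooth_on_frechet[OF f] V(2), of v]
    obtain S where S: "open S" "s \<in> S" "S \<subseteq> V" and nS: "\<And>t. t \<in> S \<Longrightarrow> unit_normal F f t (\<nu> t)"
      and \<nu>s: "\<nu> s = n"
      using \<nu> unfolding local_section_def by blast
    obtain T where T: "open T" "s \<in> T" "T \<subseteq> V" and nT: "\<And>t. t \<in> T \<Longrightarrow> riem_unit_normal h f t (\<mu> t)"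
      and \<mu>s: "\<mu> s = n - W (f s)"
      using \<mu> unfolding local_section_def by blast
    have R: "R x X Z = - 2 * \<kappa> * bf (h x) X Z" for X Z
      by (rule R_of_isotropic[OF x]) (use iso in \<open>simp add: x_def\<close>)
    have "cc x n * gm x n b (L v) = second_form x e (L u) (L v) (frechet_derivative (\<lambda>t. frechet_derivative f (at t) v) (at s) u)
        + R x (L u) (L v) - R x e e / 2 * bf (h x) (L u) (L v)"
      using randers_second_form[OF S(1,2) _ fd f2 nS local_section_differentiable[OF \<nu>]] fU S(3)
      unfolding \<nu>s b_def L_def x_def e_def by blast
    moreover have "bf (h x) a (L v) = second_form x e (L u) (L v) (frechet_derivative (\<lambda>t. frechet_derivative f (at t) v) (at s) u)"
      using riem_second_form[OF T(1,2) _ fd f2 nT local_section_differentiable[OF \<mu>]] fU T(3)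
      unfolding \<mu>s a_def L_def x_def e_def by blast
    ultimately show ?thesis unfolding R ee by simp
  qed
  obtain w where w: "\<And>v. bf (h x) (a - L w) (L v) = 0"
    using tangential_exists[OF L hpos] by blast
  have "tangential (h x) L a = w" by (rule tangential_eq[OF L hpos w])
  moreover have "tangential (fund F x n) L b = w - \<kappa> *\<^sub>R u"
  proof (rule tangential_eq[OF L])
    show "v = 0" if "bf (fund F x n) (L v) (L v) = 0" for v
      using gL[of v v] that hpos[of v] by (simp add: bf_fund[OF x n0])
    fix v
    have "cc x n * gm x n (b - L (w - \<kappa> *\<^sub>R u)) (L v)
        = cc x n * gm x n b (L v) - cc x n * gm x n (L (w - \<kappa> *\<^sub>R u)) (L v)"
      by (simp add: linear_diff[OF gm_linear(1)[OF x]] algebra_simps)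
    also have "\<dots> = bf (h x) (a - L w) (L v)"
      unfolding gL ab by (simp add: linear_diff[OF L] linear_scale[OF L])
    finally show "bf (fund F x n) (b - L (w - \<kappa> *\<^sub>R u)) (L v) = 0"
      using c w[of v] by (simp add: bf_fund[OF x n0] del: bf_diff)
  qed
  ultimately show ?thesis
    unfolding shape_operator_def riem_shape_operator_def Let_def \<nu>_def[symmetric] \<mu>_def[symmetric]
    by (simp add: x_def[symmetric] L_def[symmetric] a_def[symmetric] b_def[symmetric])
qed

end

end

section \<open>From coordinates to the manifold\<close>

lemma coord_dom_open:
  assumes M: "smooth_manifold M AM" and N: "smooth_manifold N AN" and \<phi>: "continuous_map M N \<phi>"
    and d: "d \<in> AM" and c: "c \<in> AN"
  shows "open (coord_dom d c \<phi>)"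
proof -
  have dc: "is_chart M d" "is_chart N c" using assms by (auto simp: smooth_manifold_def)
  let ?Q = "{q \<in> fst d. \<phi> q \<in> fst c}"
  have do: "openin M (fst d)" using dc by (simp add: is_chart_def)
  have "openin M {q \<in> topspace M. \<phi> q \<in> fst c}"
    using \<phi> dc by (simp add: is_chart_def openin_continuous_map_preimage)
  then have "openin M (fst d \<inter> {q \<in> topspace M. \<phi> q \<in> fst c})" using do by (rule openin_Int[rotated])
  moreover have "fst d \<inter> {q \<in> topspace M. \<phi> q \<in> fst c} = ?Q"
    using openin_subset[OF do] by auto
  ultimately have "openin (subtopology M (fst d)) ?Q"
    by (auto simp: openin_subtopology_Int2 openin_subtopology intro!: exI[of _ ?Q])
  then have "openin (top_of_set (snd d ` fst d)) (snd d ` ?Q)"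
    using dc(1) homeomorphic_imp_open_map unfolding is_chart_def open_map_def by blast
  then show ?thesis
    using dc(1) openin_open_trans unfolding is_chart_def coord_dom_def by blast
qed

lemma chart_inv_eq:
  assumes M: "smooth_manifold M AM" and d: "d \<in> AM" and q: "q \<in> fst d"
  shows "chart_inv d (snd d q) = q"
proof -
  have dc: "is_chart M d" using assms by (auto simp: smooth_manifold_def)
  have "topspace (subtopology M (fst d)) = fst d"
    using dc openin_subset[of M "fst d"] by (auto simp: is_chart_def topspace_subtopology)
  then have "inj_on (snd d) (fst d)"
    using dc homeomorphic_imp_injective_map unfolding is_chart_def by metis
  then show ?thesis unfolding chart_inv_def using q by (rule inv_into_f_f)
qed

lemma randers_data_chart:
  assumes N: "smooth_manifold N AN" and nav: "navigation_data AN h W" and c: "c \<in> AN"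
  shows "randers_data (snd c ` fst c) (h c) (W c)
    (\<lambda>x. frechet_derivative (h c) (at x)) (\<lambda>x. frechet_derivative (W c) (at x))"
proof
  show "open (snd c ` fst c)" using N c by (auto simp: smooth_manifold_def is_chart_def)
  fix x assume x: "x \<in> snd c ` fst c"
  have sm: "smooth_on (snd c ` fst c) (h c)" "smooth_on (snd c ` fst c) (W c)"
    using nav c by (auto simp: navigation_data_def riemannian_metric_def vector_field_def)
  show "(h c has_derivative frechet_derivative (h c) (at x)) (at x)"
    "(W c has_derivative frechet_derivative (W c) (at x)) (at x)"
    using sm smooth_on_has_derivative x by blast+
  show "transpose (h c x) = h c x" and "\<And>v. v \<noteq> 0 \<Longrightarrow> bf (h c x) v v > 0"
    using nav c x unfolding navigation_data_def riemannian_metric_def bf_def by blast+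
  have "sqrt (bf (h c x) (W c x) (W c x)) < 1"
    using nav c x unfolding navigation_data_def bf_def by blast
  then show "bf (h c x) (W c x) (W c x) < 1" by simp
qed

theorem theorem3p3:
  fixes N :: "'p topology" and AN :: "('p, 'n::finite) chart set"
    and M :: "'q topology" and AM :: "('q, 'm::finite) chart set"
    and h :: "('p, 'n) chart \<Rightarrow> real^'n \<Rightarrow> real^'n^'n"
    and W :: "('p, 'n) chart \<Rightarrow> real^'n \<Rightarrow> real^'n"
    and \<phi> :: "'q \<Rightarrow> 'p" and k :: "'p \<Rightarrow> real"
    and q :: 'q and c :: "('p, 'n) chart" and d :: "('q, 'm) chart" and n :: "real^'n"
  defines "F \<equiv> randers (h c) (W c)"
    and "f \<equiv> coord_rep d c \<phi>" and "V \<equiv> coord_dom d c \<phi>" and "s \<equiv> snd d q"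
  defines "A \<equiv> shape_operator F f V s n"
    and "A_bar \<equiv> riem_shape_operator (h c) f V s (n - W c (f s))"
  assumes "smooth_manifold N AN" and "smooth_manifold M AM" and "CARD('m) < CARD('n)"
    and "immersion M AM N AN \<phi>"
    and "navigation_data AN h W"
    and "isotropic_S_curvature AN h W k"
    and "d \<in> AM" and "q \<in> fst d" and "c \<in> AN" and "\<phi> q \<in> fst c"
    and "unit_normal F f s n"
  shows "(\<forall>v. principal_vector A v \<longleftrightarrow> principal_vector A_bar v) \<and>
         (\<forall>v \<kappa> \<kappa>_bar. principal_pair A v \<kappa> \<and> principal_pair A_bar v \<kappa>_bar
            \<longrightarrow> \<kappa> = \<kappa>_bar + k (\<phi> q))"
proof -
  define U where "U = snd c ` fst c"
  interpret randers_data U "h c" "W c" "\<lambda>x. frechet_derivative (h c) (at x)" "\<lambda>x. frechet_derivative (W c) (at x)"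
    unfolding U_def by (rule randers_data_chart[OF assms(7,11,15)])
  have rep: "f (snd d q') = snd c (\<phi> q')" if "q' \<in> fst d" for q'
    by (simp add: f_def coord_rep_def chart_inv_eq[OF assms(8,13) that])
  have V: "open V" unfolding V_def
    by (rule coord_dom_open[OF assms(8,7) _ assms(13,15)]) (use assms(10) in \<open>simp add: immersion_def\<close>)
  have s: "s \<in> V" using assms(14,16) by (auto simp: V_def coord_dom_def s_def)
  have fU: "f t \<in> U" if "t \<in> V" for t
    using that rep by (auto simp: V_def coord_dom_def U_def)
  have f: "smooth_on V f" and inj: "\<And>t. t \<in> V \<Longrightarrow> inj (frechet_derivative f (at t))"
    using assms(10,13,15) unfolding immersion_def V_def f_def by blast+
  have sm: "smooth_on U (h c)" "smooth_on U (W c)"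
    using assms(11,15) by (auto simp: navigation_data_def riemannian_metric_def vector_field_def U_def)
  have fs: "f s = snd c (\<phi> q)" using rep[OF assms(14)] by (simp add: s_def)
  have "S_curvature F (BH_density F) (f s) y = (real CARD('n) + 1) * k (\<phi> q) * F (f s) y" if "y \<noteq> 0" for y
    using assms(12,15,16) that unfolding isotropic_S_curvature_def fs F_def by blast
  \<comment> \<open>The rest is linear algebra: adding a multiple of the identity keeps eigenvectors
    and shifts eigenvalues.\<close>
  then have A: "A v = A_bar v + k (\<phi> q) *\<^sub>R v" for v
    unfolding A_def A_bar_def F_def
    by (intro shape_operator_eq[OF V s f fU inj sm assms(17)[unfolded F_def]]) (simp add: F_def)
  show ?thesis
  proof (intro conjI allI impI iffI)
    fix v assume "principal_vector A v"
    then obtain l where "v \<noteq> 0" "A v = l *\<^sub>R v" by (auto simp: principal_vector_def principal_pair_def)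
    then have "principal_pair A_bar v (l - k (\<phi> q))"
      using A[of v] by (simp add: principal_pair_def scaleR_diff_left eq_diff_eq)
    then show "principal_vector A_bar v" by (auto simp: principal_vector_def)
  next
    fix v assume "principal_vector A_bar v"
    then obtain l where "v \<noteq> 0" "A_bar v = l *\<^sub>R v" by (auto simp: principal_vector_def principal_pair_def)
    then have "principal_pair A v (l + k (\<phi> q))"
      using A[of v] by (simp add: principal_pair_def scaleR_add_left)
    then show "principal_vector A v" by (auto simp: principal_vector_def)
  next
    fix v l l' assume "principal_pair A v l \<and> principal_pair A_bar v l'"
    then have "v \<noteq> 0" "l *\<^sub>R v = (l' + k (\<phi> q)) *\<^sub>R v"
      using A[of v] by (auto simp: principal_pair_def scaleR_add_left)
    then show "l = l' + k (\<phi> q)" by simp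
  qed
qed

end
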